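(* For all $q \in \mathrm{SU}(2)$, the conjugate locus $\mathrm{Conj}_q(\mathrm{SU}(2))$ is a submanifold of $T^*_q(\mathrm{SU}(2))$ of codimension $1$.
   Context: Let $X_0 = \frac12\begin{pmatrix} i & 0\\ 0& -i\end{pmatrix}$, $X_1 = \frac12\begin{pmatrix} 0 & 1\\ -1& 0\end{pmatrix}$, $X_2 = \frac12\begin{pmatrix} 0 & i\\ i& 0\end{pmatrix}$ be the basis of $\mathfrak{su}(2)$, regarded as left-invariant vector fields on $\mathrm{SU}(2)$. The sub-Riemannian structure on $\mathrm{SU}(2)$ is the left-invariant one with distribution spanned by $X_1,X_2$ and metric making $X_1,X_2$ orthonormal. Its Hamiltonian is $H(q,\lambda)=\frac12(\langle\lambda,X_1(q)\rangle^2+\langle\lambda,X_2(q)\rangle^2)$ on $T^*(\mathrm{SU}(2))$. The exponential map is $\exp_q(\lambda_0)=\pi(e^{\vec H}(q,\lambda_0))$, where $e^{t\vec H}$ is the Hamiltonian flow of $H$ and $\pi:T^*(\mathrm{SU}(2))\to\mathrm{SU}(2)$ is the bundle projection; it is defined on all of $T_q^*(\mathrm{SU}(2))$. The conjugate locus at $q$ is $\mathrm{Conj}_q(\mathrm{SU}(2))=\{\lambda_0\in T^*_q(\mathrm{SU}(2)) \mid \mathrm{Ker}(d_{\lambda_0}\exp_q)\neq\{0\}\}$.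
   Formalization: The covectors with H = 0 (constant geodesics) are removed from the conjugate locus: they form a line contained in Conj_q, near 0 Conj_q equals this line (codimension 2), and elsewhere the line crosses the conjugate spheres, so Conj_q as defined is not a codimension-1 submanifold. *)

theory Defs
  imports "HOL-Analysis.Analysis"
begin

text \<open>
  Manifolds are subsets \<open>M\<close> of a Euclidean space. The cotangent space at \<open>x\<close> consists of the
  linear functionals on the tangent space at \<open>x\<close>, each represented by its unique extension to the
  ambient space that vanishes on the orthogonal complement of the tangent space. This makes the
  cotangent bundle a subset of a normed space, so that \<^const>\<open>has_derivative\<close> applies to it.
\<close>

definition tangent_space :: "'a::real_normed_vector set \<Rightarrow> 'a \<Rightarrow> 'a set" where
  "tangent_space M x =
     {v. \<exists>c :: real \<Rightarrow> 'a. (\<forall>t. c t \<in> M) \<and> c 0 = x \<and> (c has_vector_derivative v) (at 0)}"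

definition cotangent_space :: "'a::euclidean_space set \<Rightarrow> 'a \<Rightarrow> ('a \<Rightarrow>\<^sub>L real) set" where
  "cotangent_space M x =
     {p. \<forall>w. (\<forall>v\<in>tangent_space M x. w \<bullet> v = 0) \<longrightarrow> blinfun_apply p w = 0}"

definition cotangent_bundle :: "'a::euclidean_space set \<Rightarrow> ('a \<times> ('a \<Rightarrow>\<^sub>L real)) set" where
  "cotangent_bundle M = Sigma M (cotangent_space M)"

text \<open>
  The Liouville one-form of the cotangent bundle maps \<open>(v, \<alpha>)\<close> at \<open>(x, p)\<close> to \<open>p v\<close>; it is the
  restriction of the Liouville form of the ambient cotangent bundle, and its exterior derivative is
  the restriction of the constant form below. The sign conventions are \<open>\<sigma> = dp \<and> dx\<close> and
  \<open>\<sigma>(\<cdot>, X\<^sub>H) = dH\<close>, so that \<open>x' = \<partial>H/\<partial>p\<close> and \<open>p' = - \<partial>H/\<partial>x\<close>.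
\<close>

definition symplectic_form ::
    "'a::real_normed_vector \<times> ('a \<Rightarrow>\<^sub>L real) \<Rightarrow> 'a \<times> ('a \<Rightarrow>\<^sub>L real) \<Rightarrow> real" where
  "symplectic_form Y X = blinfun_apply (snd Y) (fst X) - blinfun_apply (snd X) (fst Y)"

text \<open>
  The Frechet derivative within a submanifold is determined only on vectors tangent to it, and
  is applied to such vectors only, both here and in the definition of the conjugate locus.
\<close>

definition hamiltonian_vector_field ::
    "'a::euclidean_space set \<Rightarrow> ('a \<times> ('a \<Rightarrow>\<^sub>L real) \<Rightarrow> real) \<Rightarrow>
     'a \<times> ('a \<Rightarrow>\<^sub>L real) \<Rightarrow> 'a \<times> ('a \<Rightarrow>\<^sub>L real)" where
  "hamiltonian_vector_field M H z =
     (THE X. X \<in> tangent_space (cotangent_bundle M) z \<and>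
        (\<forall>Y\<in>tangent_space (cotangent_bundle M) z.
           symplectic_form Y X = frechet_derivative H (at z within cotangent_bundle M) Y))"

definition hamiltonian_flow ::
    "'a::euclidean_space set \<Rightarrow> ('a \<times> ('a \<Rightarrow>\<^sub>L real) \<Rightarrow> real) \<Rightarrow> real \<Rightarrow>
     'a \<times> ('a \<Rightarrow>\<^sub>L real) \<Rightarrow> 'a \<times> ('a \<Rightarrow>\<^sub>L real)" where
  "hamiltonian_flow M H t z =
     (THE \<gamma>. \<gamma> 0 = z \<and>
        (\<forall>s::real. \<gamma> s \<in> cotangent_bundle M \<and>
           (\<gamma> has_vector_derivative hamiltonian_vector_field M H (\<gamma> s)) (at s))) t"

definition SU2 :: "(complex^2^2) set" where
  "SU2 = {q. (\<chi> i j. cnj (q $ j $ i)) ** q = mat 1 \<and> det q = 1}"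

definition X1 :: "complex^2^2 \<Rightarrow> complex^2^2" where
  "X1 q = q ** ((1/2) *\<^sub>R vector [vector [0, 1], vector [- 1, 0]])"

definition X2 :: "complex^2^2 \<Rightarrow> complex^2^2" where
  "X2 q = q ** ((1/2) *\<^sub>R vector [vector [0, \<i>], vector [\<i>, 0]])"

definition SU2_hamiltonian :: "(complex^2^2) \<times> ((complex^2^2) \<Rightarrow>\<^sub>L real) \<Rightarrow> real" where
  "SU2_hamiltonian =
     (\<lambda>(q, p). 1/2 * ((blinfun_apply p (X1 q))\<^sup>2 + (blinfun_apply p (X2 q))\<^sup>2))"

definition SU2_exp :: "complex^2^2 \<Rightarrow> ((complex^2^2) \<Rightarrow>\<^sub>L real) \<Rightarrow> complex^2^2" where
  "SU2_exp q p = fst (hamiltonian_flow SU2 SU2_hamiltonian 1 (q, p))"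

text \<open>
  The conjugate locus contains every covector \<open>p\<close> with \<open>SU2_hamiltonian (q, p) = 0\<close>: these
  covectors form a line consisting of equilibria of the flow, so \<open>SU2_exp q\<close> is constant on it.
  In the left-trivialised coordinates \<open>h\<^sub>0, h\<^sub>1, h\<^sub>2\<close> with \<open>r\<^sup>2 = h\<^sub>1\<^sup>2 + h\<^sub>2\<^sup>2\<close> and
  \<open>\<omega> = 2 \<tau> = sqrt (h\<^sub>0\<^sup>2 + r\<^sup>2)\<close>, the Jacobian of \<open>SU2_exp q\<close> is a constant multiple of
  \<open>r\<^sup>2 sin \<tau> (sin \<tau> - \<tau> cos \<tau>) / \<omega>\<^sup>4\<close>, so the conjugate locus is the union of that line and of
  spheres crossing it. It is a surface only away from the line, i.e. for covectors of nonconstant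
  geodesics.
\<close>

definition conjugate_locus :: "complex^2^2 \<Rightarrow> ((complex^2^2) \<Rightarrow>\<^sub>L real) set" where
  "conjugate_locus q =
     {p \<in> cotangent_space SU2 q.
        {\<mu> \<in> cotangent_space SU2 q.
           frechet_derivative (SU2_exp q) (at p within cotangent_space SU2 q) \<mu> = 0} \<noteq> {0}}"

text \<open>
  Smoothness on open subsets of finite-dimensional spaces, through iterated directional derivatives.
\<close>

primrec Ck_on ::
    "nat \<Rightarrow> 'a::real_normed_vector set \<Rightarrow> ('a \<Rightarrow> 'b::real_normed_vector) \<Rightarrow> bool" where
  "Ck_on 0 U f \<longleftrightarrow> continuous_on U f"
| "Ck_on (Suc k) U f \<longleftrightarrow>
     (\<forall>x\<in>U. f differentiable (at x)) \<and> (\<forall>v. Ck_on k U (\<lambda>x. frechet_derivative f (at x) v))"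

definition smooth_on ::
    "'a::real_normed_vector set \<Rightarrow> ('a \<Rightarrow> 'b::real_normed_vector) \<Rightarrow> bool" where
  "smooth_on U f \<longleftrightarrow> (\<forall>k. Ck_on k U f)"

text \<open>
  Embedded submanifolds \<open>S\<close> of codimension \<open>d\<close> of a finite-dimensional linear subspace \<open>V\<close>, by slice
  charts. A chart \<open>\<phi>\<close> is a diffeomorphism between open sets of the ambient space that preserves \<open>V\<close>;
  every slice chart of \<open>V\<close> extends to such a diffeomorphism along a complement of \<open>V\<close>.
\<close>

definition submanifold_of_codim ::
    "nat \<Rightarrow> 'a::real_normed_vector set \<Rightarrow> 'a set \<Rightarrow> bool" where
  "submanifold_of_codim d V S \<longleftrightarrow>
     S \<subseteq> V \<and>
     (\<forall>x\<in>S. \<exists>U \<phi> \<psi> W.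
        open U \<and> x \<in> U \<and> open (\<phi> ` U) \<and>
        smooth_on U \<phi> \<and> smooth_on (\<phi> ` U) \<psi> \<and> (\<forall>y\<in>U. \<psi> (\<phi> y) = y) \<and>
        \<phi> ` (U \<inter> V) = \<phi> ` U \<inter> V \<and>
        subspace W \<and> W \<subseteq> V \<and> dim W + d = dim V \<and>
        \<phi> ` (U \<inter> S) = \<phi> ` U \<inter> W)"

end

theory Submission
  imports Defs
begin

text \<open>
  Left-trivialise \<open>T\<^sup>*SU(2)\<close> by \<open>(q, h)\<close> with \<open>h\<close> in \<open>\<real>\<^sup>3\<close>. Hamilton's equations become
  \<open>q' = q (h\<^sub>1 X\<^sub>1 + h\<^sub>2 X\<^sub>2)\<close> and a rotation of \<open>(h\<^sub>1, h\<^sub>2)\<close> with speed \<open>h\<^sub>0\<close>; conjugating by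
  \<open>exp (t h\<^sub>0 X\<^sub>0)\<close> makes them constant, so the geodesic is \<open>q exp (t h) exp (- t h\<^sub>0 X\<^sub>0)\<close>. The kernel of its
  differential at \<open>t = 1\<close> is a \<open>3 \<times> 3\<close> linear system, solvable off the line \<open>h\<^sub>1 = h\<^sub>2 = 0\<close> exactly if
  \<open>sin \<tau> (sin \<tau> - \<tau> cos \<tau>) = 0\<close> for \<open>\<tau> = |h| / 2\<close>. The positive zeros of this function are simple, hence
  isolated, so the conjugate locus is locally a sphere \<open>|h| = const\<close>.
\<close>

section \<open>Smooth maps and spheres\<close>

text \<open>The vector field and the flow are definite descriptions, so explicit formulae count only
  together with uniqueness: nondegeneracy of the symplectic form gives it for the field, and
  integrating factors give it for the flow, being expressions that are constant along every solution
  and recover it from its initial value. Matrices form a real space of dimension 8, so derivatives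
  within the bundle or within a cotangent space are fixed on tangent vectors only; they are
  evaluated by running a curve through the point. \<open>covector\<close> and
  \<open>momentum\<close> are bilinear on the ambient spaces, which lets the trivialisation itself
  be differentiated by the product rule. The chart that straightens a sphere must be a
  diffeomorphism between open sets of the whole dual space that respects the cotangent space; it
  therefore moves points only along a direction inside that space, and its inverse is
  explicit.\<close>

lemma Ck_on_cong:
  assumes "open U" "\<And>x. x \<in> U \<Longrightarrow> f x = g x"
  shows "Ck_on k U f \<longleftrightarrow> Ck_on k U g"
  using assms(2)
proof (induction k arbitrary: f g)
  case 0
  then show ?case by (simp cong: continuous_on_cong)
next
  case (Suc k)
  have transfer: "(f has_derivative D) (at x) \<longleftrightarrow> (g has_derivative D) (at x)" if "x \<in> U" for x D
    using has_derivative_transform_within_open[of f D x UNIV U g]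
      has_derivative_transform_within_open[of g D x UNIV U f] assms(1) that Suc.prems by auto
  then have "f differentiable at x \<longleftrightarrow> g differentiable at x" if "x \<in> U" for x
    unfolding differentiable_def using that by blast
  moreover have "Ck_on k U (\<lambda>x. frechet_derivative f (at x) v)
      \<longleftrightarrow> Ck_on k U (\<lambda>x. frechet_derivative g (at x) v)" for v
    by (rule Suc.IH) (simp add: frechet_derivative_def transfer)
  ultimately show ?case by auto
qed

text \<open>Passes from the choice made by \<open>frechet_derivative\<close> to any explicit
  derivative \<open>D\<close>, so that the inductions on \<open>k\<close> below can run on
  formulae.\<close>

lemma Ck_on_SucI:
  assumes "open U" "\<And>x. x \<in> U \<Longrightarrow> (f has_derivative D x) (at x)"
    and "\<And>v. Ck_on k U (\<lambda>x. D x v)"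
  shows "Ck_on (Suc k) U f"
proof -
  have "Ck_on k U (\<lambda>x. frechet_derivative f (at x) v)" for v
    using assms(2,3) by (subst Ck_on_cong[OF assms(1), where g = "\<lambda>x. D x v"])
      (simp_all add: frechet_derivative_at[symmetric, OF assms(2)])
  then show ?thesis
    using assms(2) by (auto simp: differentiable_def)
qed

lemma Ck_on_SucD:
  assumes "Ck_on (Suc k) U f"
  obtains D where "\<And>x. x \<in> U \<Longrightarrow> (f has_derivative D x) (at x)" "\<And>v. Ck_on k U (\<lambda>x. D x v)"
  using assms that[of "\<lambda>x. frechet_derivative f (at x)"]
  by (auto simp: frechet_derivative_works)

lemma Ck_on_SucD_Ck_on: "Ck_on (Suc k) U f \<Longrightarrow> Ck_on k U f"
proof (induction k arbitrary: f)
  case 0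
  then show ?case
    by (auto intro!: differentiable_imp_continuous_on
        simp: differentiable_on_def differentiable_at_withinI)
next
  case (Suc k)
  show ?case
    unfolding Ck_on.simps(2)[of k]
  proof (intro conjI allI)
    show "\<forall>x\<in>U. f differentiable at x"
      using Suc.prems by simp
    show "Ck_on k U (\<lambda>x. frechet_derivative f (at x) v)" for v
      using Suc.prems by (intro Suc.IH) (simp only: Ck_on.simps(2)[of "Suc k"])
  qed
qed

lemma Ck_on_subset: "Ck_on k U f \<Longrightarrow> T \<subseteq> U \<Longrightarrow> Ck_on k T f"
  by (induction k arbitrary: f) (auto intro: continuous_on_subset)

lemma Ck_on_const: "Ck_on k U (\<lambda>x. c)"
  by (induction k arbitrary: c) auto

lemma Ck_on_add:
  assumes "open U" "Ck_on k U f" "Ck_on k U g"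
  shows "Ck_on k U (\<lambda>x. f x + g x)"
  using assms(2,3)
proof (induction k arbitrary: f g)
  case 0
  then show ?case by (auto intro: continuous_intros)
next
  case (Suc k)
  obtain F where F: "\<And>x. x \<in> U \<Longrightarrow> (f has_derivative F x) (at x)" "\<And>v. Ck_on k U (\<lambda>x. F x v)"
    using Suc.prems(1) by (rule Ck_on_SucD) blast
  obtain G where G: "\<And>x. x \<in> U \<Longrightarrow> (g has_derivative G x) (at x)" "\<And>v. Ck_on k U (\<lambda>x. G x v)"
    using Suc.prems(2) by (rule Ck_on_SucD) blast
  show ?case
    by (rule Ck_on_SucI[OF assms(1), where D = "\<lambda>x v. F x v + G x v"])
      (use F G Suc.IH in \<open>auto intro!: derivative_eq_intros\<close>)
qed

text \<open>The product rule yields two terms of the same bilinear shape, so the induction closes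
  when \<open>f\<close> and \<open>g\<close> are arbitrary; the undifferentiated factor is first
  lowered from \<open>Suc k\<close> to \<open>k\<close>. Products, scalings and inner products are
  all instances.\<close>

lemma Ck_on_bilinear:
  assumes B: "bounded_bilinear B" and "open U" "Ck_on k U f" "Ck_on k U g"
  shows "Ck_on k U (\<lambda>x. B (f x) (g x))"
  using assms(3,4)
proof (induction k arbitrary: f g)
  case 0
  then show ?case by (auto intro: bounded_bilinear.continuous_on[OF B])
next
  case (Suc k)
  obtain F where F: "\<And>x. x \<in> U \<Longrightarrow> (f has_derivative F x) (at x)" "\<And>v. Ck_on k U (\<lambda>x. F x v)"
    using Suc.prems(1) by (rule Ck_on_SucD) blast
  obtain G where G: "\<And>x. x \<in> U \<Longrightarrow> (g has_derivative G x) (at x)" "\<And>v. Ck_on k U (\<lambda>x. G x v)"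
    using Suc.prems(2) by (rule Ck_on_SucD) blast
  show ?case
  proof (rule Ck_on_SucI[OF assms(2), where D = "\<lambda>x v. B (f x) (G x v) + B (F x v) (g x)"])
    show "((\<lambda>x. B (f x) (g x)) has_derivative (\<lambda>v. B (f x) (G x v) + B (F x v) (g x))) (at x)"
      if "x \<in> U" for x
      using bounded_bilinear.FDERIV[OF B F(1)[OF that] G(1)[OF that]] .
    show "Ck_on k U (\<lambda>x. B (f x) (G x v) + B (F x v) (g x))" for v
      using Ck_on_add[OF assms(2) Suc.IH[OF Ck_on_SucD_Ck_on[OF Suc.prems(1)] G(2)]
          Suc.IH[OF F(2) Ck_on_SucD_Ck_on[OF Suc.prems(2)]]] .
  qed
qed

lemma Ck_on_bounded_linear:
  assumes "bounded_linear f" "open U"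
  shows "Ck_on k U f"
proof (cases k)
  case 0
  then show ?thesis
    using assms linear_continuous_on by auto
next
  case (Suc l)
  show ?thesis
    unfolding Suc
    by (rule Ck_on_SucI[OF assms(2), where D = "\<lambda>_. f"])
      (use assms in \<open>auto intro: bounded_linear_imp_has_derivative Ck_on_const\<close>)
qed

text \<open>Differentiation lowers the exponent by one, so the induction must range over all
  \<open>a\<close>, although the chart below only takes \<open>a = 1/2\<close>.\<close>

lemma Ck_on_powr:
  fixes f :: "'a::real_normed_vector \<Rightarrow> real"
  assumes "open U" "\<And>x. x \<in> U \<Longrightarrow> f x > 0" "Ck_on k U f"
  shows "Ck_on k U (\<lambda>x. f x powr a)"
  using assms(3)
proof (induction k arbitrary: a)
  case 0
  then show ?case
    using assms(2) by (force intro!: continuous_on_powr continuous_on_const)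
next
  case (Suc k)
  obtain F where F: "\<And>x. x \<in> U \<Longrightarrow> (f has_derivative F x) (at x)" "\<And>v. Ck_on k U (\<lambda>x. F x v)"
    using Suc.prems by (rule Ck_on_SucD) blast
  show ?case
  proof (rule Ck_on_SucI[OF assms(1), where D = "\<lambda>x v. (a * f x powr (a - 1)) * F x v"])
    show "((\<lambda>x. f x powr a) has_derivative (\<lambda>v. a * f x powr (a - 1) * F x v)) (at x)"
      if "x \<in> U" for x
      using assms(2)[OF that] F(1)[OF that]
      by (auto intro!: derivative_eq_intros simp: powr_diff)
    show "Ck_on k U (\<lambda>x. a * f x powr (a - 1) * F x v)" for v
      using Ck_on_bilinear[OF bounded_bilinear_mult assms(1)
          Ck_on_bilinear[OF bounded_bilinear_mult assms(1) Ck_on_const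
            Suc.IH[OF Ck_on_SucD_Ck_on[OF Suc.prems]]] F(2)] .
  qed
qed

text \<open>Straightening a sphere: the radial coordinate along \<open>x\<close> is exchanged for the squared norm.\<close>

lemma submanifold_of_codim_1_locally_sphere:
  fixes L :: "'a::real_normed_vector \<Rightarrow> 'b::euclidean_space"
  assumes L: "bounded_linear L" and V: "subspace V" and bij: "bij_betw L V UNIV" and "S \<subseteq> V"
    and local: "\<And>x. x \<in> S \<Longrightarrow> L x \<noteq> 0 \<and>
      (\<exists>T. open T \<and> x \<in> T \<and> (\<forall>p\<in>T \<inter> V. p \<in> S \<longleftrightarrow> norm (L p) = norm (L x)))"
  shows "submanifold_of_codim 1 V S"
  unfolding submanifold_of_codim_def
proof (intro conjI ballI)
  show "S \<subseteq> V" by fact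
next
  fix x assume "x \<in> S"
  from local[OF this] obtain T where "L x \<noteq> 0" and T: "open T" "x \<in> T"
    and TS: "\<And>p. p \<in> T \<Longrightarrow> p \<in> V \<Longrightarrow> p \<in> S \<longleftrightarrow> norm (L p) = norm (L x)" by blast
  have "x \<in> V" using \<open>x \<in> S\<close> \<open>S \<subseteq> V\<close> by blast
  interpret L: bounded_linear L by fact
  define c where "c = norm (L x)"
  have "c > 0" unfolding c_def using \<open>L x \<noteq> 0\<close> by simp
  have Lx: "L x \<bullet> L x = c * c"
    unfolding c_def by (metis dot_square_norm power2_eq_square)
  \<comment> \<open>\<open>L u\<close> is the unit vector through \<open>L x\<close>, and
    \<open>l\<close> is the coordinate in this direction.\<close>
  define u where "u = x /\<^sub>R c"
  have "u \<in> V" unfolding u_def using \<open>x \<in> V\<close> V by (simp add: subspace_scale)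
  have Lu: "L u \<bullet> L u = 1"
    unfolding u_def using \<open>c > 0\<close> by (simp add: L.scaleR Lx field_simps)
  define l where "l p = L p \<bullet> L u" for p
  have l: "bounded_linear l"
    unfolding l_def by (intro bounded_linear_inner_left_comp L)
  interpret l: bounded_linear l by fact
  have lu: "l u = 1" by (simp add: l_def Lu)
  have lx: "l x = c"
    unfolding l_def u_def using \<open>c > 0\<close> by (simp add: L.scaleR Lx field_simps)
  \<comment> \<open>Only the coefficient along \<open>u\<close> changes: from \<open>l p\<close> to
    \<open>L p \<bullet> L p - c\<^sup>2\<close>, which vanishes exactly on the sphere of radius
    \<open>c\<close>.\<close>
  define \<phi> where "\<phi> p = p + (L p \<bullet> L p - c\<^sup>2 - l p) *\<^sub>R u" for p
  \<comment> \<open>At \<open>y = \<phi> p\<close> the squared norm of \<open>L p\<close> is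
    \<open>l y + c\<^sup>2\<close>, while the part of \<open>L p\<close> orthogonal to
    \<open>L u\<close> is unchanged and has squared norm
    \<open>L y \<bullet> L y - l y * l y\<close>. The difference \<open>\<rho> y\<close> is thus the
    square of \<open>l p\<close>.\<close>
  define \<rho> where "\<rho> y = l y + c\<^sup>2 - L y \<bullet> L y + l y * l y" for y
  define \<psi> where "\<psi> y = y + (\<rho> y powr (1/2) - l y) *\<^sub>R u" for y
  have l\<phi>: "l (\<phi> p) = L p \<bullet> L p - c\<^sup>2" for p
    by (simp add: \<phi>_def l.add l.scaleR lu)
  have L_eq: "L (p + a *\<^sub>R u) \<bullet> L (p + a *\<^sub>R u) = L p \<bullet> L p + 2 * a * l p + a\<^sup>2" for p a
    by (simp add: L.add L.scaleR inner_add inner_commute Lu l_def power2_eq_square algebra_simps)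
  have \<rho>\<phi>: "\<rho> (\<phi> p) = (l p)\<^sup>2" for p
    unfolding \<rho>_def l\<phi>
    unfolding \<phi>_def L_eq by (simp add: power2_eq_square algebra_simps)
  have \<psi>\<phi>: "\<psi> (\<phi> p) = p" if "l p > 0" for p
    unfolding \<psi>_def \<rho>\<phi> l\<phi> using that
    by (simp add: powr_half_sqrt \<phi>_def algebra_simps)
  have l\<psi>: "l (\<psi> y) = sqrt (\<rho> y)" if "\<rho> y > 0" for y
    using that by (simp add: \<psi>_def l.add l.scaleR lu powr_half_sqrt)
  have \<phi>\<psi>: "\<phi> (\<psi> y) = y" if "\<rho> y > 0" for y
  proof -
    have "L (\<psi> y) \<bullet> L (\<psi> y) = l y + c\<^sup>2"
      using that unfolding \<psi>_def L_eq
      by (simp add: powr_half_sqrt power2_eq_square algebra_simps) (simp add: \<rho>_def power2_eq_square algebra_simps)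
    then show ?thesis
      using that by (simp add: \<phi>_def l\<psi>) (simp add: \<psi>_def powr_half_sqrt algebra_simps)
  qed
  \<comment> \<open>In this half space \<open>l p\<close> is the positive root of
    \<open>\<rho> (\<phi> p)\<close>, the one that \<open>\<psi>\<close> takes.\<close>
  define U where "U = T \<inter> {p. l p > 0}"
  have "open U"
    unfolding U_def using T(1)
    by (intro open_Int open_Collect_less continuous_intros l.continuous_on)
  have "x \<in> U" using T \<open>c > 0\<close> by (simp add: U_def lx)
  \<comment> \<open>Writing the image as a preimage under \<open>\<psi>\<close> reduces its openness
    to continuity of \<open>\<psi>\<close>.\<close>
  have image: "\<phi> ` U = {y. \<rho> y > 0} \<inter> \<psi> -` T"
  proof safe
    fix p assume "p \<in> U"
    then show "\<rho> (\<phi> p) > 0" "\<phi> p \<in> \<psi> -` T" by (auto simp: U_def \<rho>\<phi> \<psi>\<phi>)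
  next
    fix y assume "\<rho> y > 0" "\<psi> y \<in> T"
    then have "\<psi> y \<in> U" "y = \<phi> (\<psi> y)" by (auto simp: U_def l\<psi> \<phi>\<psi>)
    then show "y \<in> \<phi> ` U" by blast
  qed
  have open_\<rho>: "open {y. \<rho> y > 0}"
    unfolding \<rho>_def
    by (intro open_Collect_less continuous_intros l.continuous_on L.continuous_on)
  have "continuous_on {y. \<rho> y > 0} \<psi>"
    unfolding \<psi>_def using less_imp_neq unfolding \<rho>_def
    by (intro continuous_intros l.continuous_on L.continuous_on) auto
  then have "open (\<phi> ` U)"
    unfolding image using continuous_on_open_vimage[OF open_\<rho>] T(1)
    by (metis inf_commute)
  have l_Ck: "Ck_on k Z l" if "open Z" for k Z
    by (rule Ck_on_bounded_linear[OF l that])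
  have id_Ck: "Ck_on k Z (\<lambda>p. p)" if "open Z" for k and Z :: "'a set"
    by (rule Ck_on_bounded_linear[OF bounded_linear_ident that])
  have L_Ck: "Ck_on k Z (\<lambda>p. L p \<bullet> L p)" if "open Z" for k Z
    by (intro Ck_on_bilinear[OF bounded_bilinear_inner that] Ck_on_bounded_linear L that)
  have diff: "Ck_on k Z (\<lambda>p. f p - g p)" if "open Z" "Ck_on k Z f" "Ck_on k Z g"
    for k and Z :: "'a set" and f g :: "'a \<Rightarrow> real"
    using Ck_on_add[OF that(1,2), of "\<lambda>p. - 1 * g p"]
      Ck_on_bilinear[OF bounded_bilinear_mult that(1) Ck_on_const[of k Z "-1"] that(3)] by simp
  have scale: "Ck_on k Z (\<lambda>p. p + f p *\<^sub>R u)" if "open Z" "Ck_on k Z f"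
    for k and Z :: "'a set" and f :: "'a \<Rightarrow> real"
    by (rule Ck_on_add[OF that(1) id_Ck[OF that(1)]
          Ck_on_bilinear[OF bounded_bilinear_scaleR that Ck_on_const]])
  have "smooth_on U \<phi>"
    unfolding smooth_on_def \<phi>_def
    using scale[OF \<open>open U\<close> diff[OF \<open>open U\<close> diff[OF \<open>open U\<close> L_Ck[OF \<open>open U\<close>] Ck_on_const]
          l_Ck[OF \<open>open U\<close>]]] by blast
  moreover have "smooth_on {y. \<rho> y > 0} \<psi>"
  proof -
    have "Ck_on k {y. \<rho> y > 0} \<rho>" for k
      unfolding \<rho>_def[abs_def] using open_\<rho>[unfolded \<rho>_def]
      by (intro Ck_on_add diff Ck_on_bilinear[OF bounded_bilinear_mult] l_Ck L_Ck Ck_on_const)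
    then have "Ck_on k {y. \<rho> y > 0} (\<lambda>y. \<rho> y powr (1/2))" for k
      by (intro Ck_on_powr open_\<rho>) auto
    from scale[OF open_\<rho> diff[OF open_\<rho> this l_Ck[OF open_\<rho>]]]
    show ?thesis
      unfolding smooth_on_def \<psi>_def by blast
  qed
  then have "smooth_on (\<phi> ` U) \<psi>"
    unfolding smooth_on_def image by (meson Ck_on_subset inf_le1)
  moreover have "\<forall>y\<in>U. \<psi> (\<phi> y) = y"
    by (simp add: U_def \<psi>\<phi>)
  moreover have inV: "\<phi> p \<in> V \<longleftrightarrow> p \<in> V" for p
  proof -
    have "(L p \<bullet> L p - c\<^sup>2 - l p) *\<^sub>R u \<in> V" (is "?w \<in> V")
      using V \<open>u \<in> V\<close> by (rule subspace_scale)
    then show ?thesis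
      using subspace_add[OF V, of p ?w] subspace_diff[OF V, of "\<phi> p" ?w]
      by (auto simp: \<phi>_def)
  qed
  moreover define W where "W = {p \<in> V. l p = 0}"
  have "subspace W"
    unfolding W_def using V by (auto simp: subspace_def l.add l.scaleR l.zero)
  moreover have "dim W + 1 = dim V"
  proof -
    \<comment> \<open>\<open>L\<close> is injective on \<open>V\<close> only; its inverse there
      carries the hyperplane orthogonal to \<open>L u\<close> onto \<open>W\<close>, whose dimension
      can then be counted in the Euclidean space.\<close>
    define K where "K = inv_into V L"
    have K: "K b \<in> V" "L (K b) = b" for b
      using bij bij_betw_imp_surj_on[OF bij] by (auto simp: K_def inv_into_into f_inv_into_f)
    have KL: "K (L p) = p" if "p \<in> V" for p
      unfolding K_def using bij that by (simp add: bij_betw_def)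
    have "linear K"
    proof (rule linearI)
      show "K (a + b) = K a + K b" for a b
        using KL[of "K a + K b"] K V by (simp add: L.add subspace_add)
      show "K (r *\<^sub>R b) = r *\<^sub>R K b" for r b
        using KL[of "r *\<^sub>R K b"] K V by (simp add: L.scaleR subspace_scale)
    qed
    have "inj K"
      by (metis K(2) injI)
    then have "dim (K ` B) = dim B" for B
      by (intro dim_image_eq[OF \<open>linear K\<close>]) (rule inj_on_subset[OF _ subset_UNIV])
    moreover have "K ` UNIV = V"
      using K(1) KL by (metis UNIV_I image_eqI subsetI subset_antisym image_subset_iff)
    moreover have "K ` {b. L u \<bullet> b = 0} = W"
    proof safe
      fix b assume "L u \<bullet> b = 0"
      then show "K b \<in> W" using K by (simp add: W_def l_def inner_commute)
    next
      fix p assume "p \<in> W"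
      then have "p = K (L p)" "L u \<bullet> L p = 0" by (auto simp: W_def KL l_def inner_commute)
      then show "p \<in> K ` {b. L u \<bullet> b = 0}" by blast
    qed
    moreover have "dim {b. L u \<bullet> b = 0} = DIM('b) - 1"
      by (rule dim_hyperplane) (use Lu in auto)
    ultimately show ?thesis
      by (metis DIM_positive Suc_eq_plus1 Suc_pred' dim_UNIV One_nat_def)
  qed
  moreover have "\<phi> ` (U \<inter> S) = \<phi> ` U \<inter> W"
  proof -
    have "p \<in> S \<longleftrightarrow> \<phi> p \<in> W" if "p \<in> U" for p
    proof -
      have "l (\<phi> p) = 0 \<longleftrightarrow> norm (L p) = norm (L x)"
        using \<open>c > 0\<close> unfolding l\<phi> dot_square_norm by (simp flip: c_def)
      with TS that \<open>S \<subseteq> V\<close> show ?thesis by (auto simp: W_def inV U_def)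
    qed
    then show ?thesis by auto
  qed
  ultimately show "\<exists>U \<phi> \<psi> W. open U \<and> x \<in> U \<and> open (\<phi> ` U) \<and> smooth_on U \<phi> \<and> smooth_on (\<phi> ` U) \<psi> \<and>
      (\<forall>y\<in>U. \<psi> (\<phi> y) = y) \<and> \<phi> ` (U \<inter> V) = \<phi> ` U \<inter> V \<and> subspace W \<and> W \<subseteq> V \<and>
      dim W + 1 = dim V \<and> \<phi> ` (U \<inter> S) = \<phi> ` U \<inter> W"
    using \<open>open U\<close> \<open>x \<in> U\<close> \<open>open (\<phi> ` U)\<close>
    by (intro exI[of _ U] exI[of _ \<phi>] exI[of _ \<psi>] exI[of _ W]) (auto simp: W_def)
qed

section \<open>The group and its Lie algebra\<close>

text \<open>The components \<open>1, 2, 3\<close> belong to the basis \<open>X\<^sub>0, X\<^sub>1, X\<^sub>2\<close> of \<open>su(2)\<close>.\<close>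

definition su :: "real^3 \<Rightarrow> complex^2^2" where
  "su a = (1/2) *\<^sub>R vector [vector [Complex 0 (a$1), Complex (a$2) (a$3)],
                           vector [Complex (- a$2) (a$3), Complex 0 (- a$1)]]"

definition hconj :: "complex^2^2 \<Rightarrow> complex^2^2" where
  "hconj q = (\<chi> i j. cnj (q $ j $ i))"

lemmas mat2_simps = vec_eq_iff forall_2 sum_2 matrix_matrix_mult_def su_def hconj_def mat_def
  complex_eq_iff

lemma bounded_bilinear_matrix_mult: "bounded_bilinear ((**) :: complex^2^2 \<Rightarrow> complex^2^2 \<Rightarrow> complex^2^2)"
  unfolding bilinear_conv_bounded_bilinear[symmetric]
  by (auto simp: bilinear_def mat2_simps algebra_simps intro!: linearI)

interpretation mm: bounded_bilinear "(**) :: complex^2^2 \<Rightarrow> complex^2^2 \<Rightarrow> complex^2^2"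
  by (rule bounded_bilinear_matrix_mult)

lemma bounded_linear_su: "bounded_linear su"
  unfolding linear_conv_bounded_linear[symmetric]
  by (auto simp: mat2_simps algebra_simps intro!: linearI)

lemmas su_add = linear_add[OF bounded_linear.linear[OF bounded_linear_su]]
lemmas su_diff = linear_diff[OF bounded_linear.linear[OF bounded_linear_su]]
lemmas su_zero = linear_0[OF bounded_linear.linear[OF bounded_linear_su]]
lemmas su_minus = linear_neg[OF bounded_linear.linear[OF bounded_linear_su]]
lemmas su_scaleR = linear_scale[OF bounded_linear.linear[OF bounded_linear_su]]

lemma bounded_linear_hconj: "bounded_linear hconj"
  unfolding linear_conv_bounded_linear[symmetric]
  by (auto simp: mat2_simps algebra_simps intro!: linearI)

lemmas hconj_add = linear_add[OF bounded_linear.linear[OF bounded_linear_hconj]]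
lemmas hconj_scaleR = linear_scale[OF bounded_linear.linear[OF bounded_linear_hconj]]

text \<open>Multiplication of imaginary quaternions, with \<open>2 *\<^sub>R su a\<close> in the
  role of the imaginary quaternion \<open>a\<close>; hence the factors 1/4 and 1/2.\<close>

lemma su_mult_su: "su a ** su b = (- (a \<bullet> b) / 4) *\<^sub>R mat 1 + (1/2) *\<^sub>R su (cross3 a b)"
  by (simp add: mat2_simps cross3_def inner_vec_def sum_3 field_simps)

lemma inner_su_su: "su a \<bullet> su b = (a \<bullet> b) / 2"
  by (simp add: su_def inner_vec_def sum_2 sum_3 inner_complex_def algebra_simps)

lemma inner_one_su: "mat 1 \<bullet> su b = 0"
  by (simp add: su_def mat_def inner_vec_def sum_2 sum_3 inner_complex_def algebra_simps)

lemma hconj_su: "hconj (su a) = - su a"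
  by (simp add: mat2_simps)

lemma hconj_one: "hconj (mat 1) = mat 1"
  by (simp add: mat2_simps)

lemma hconj_mult: "hconj (x ** y) = hconj y ** hconj x"
  by (simp add: mat2_simps algebra_simps)

lemma inner_mult_left: "(q ** x) \<bullet> y = x \<bullet> (hconj q ** y)" for x y :: "complex^2^2"
  by (simp add: inner_vec_def hconj_def matrix_matrix_mult_def sum_2 inner_complex_def algebra_simps)

lemma one_su_indep: "a *\<^sub>R mat 1 + su b = 0 \<longleftrightarrow> a = 0 \<and> b = 0"
  by (auto simp: mat2_simps forall_3)

lemma su_eq_iff: "su a = su b \<longleftrightarrow> a = b"
  by (auto simp: mat2_simps forall_3)

section \<open>The group inside the quaternions\<close>

lemma SU2_iff: "q \<in> SU2 \<longleftrightarrow> hconj q ** q = mat 1 \<and> det q = 1"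
  by (simp add: SU2_def hconj_def)

lemma SU2_left: "q \<in> SU2 \<Longrightarrow> hconj q ** q = mat 1"
  by (simp add: SU2_iff)

lemma SU2_right: "q \<in> SU2 \<Longrightarrow> q ** hconj q = mat 1"
  using matrix_left_right_inverse by (simp add: SU2_iff) blast

lemma SU2_mult: "p \<in> SU2 \<Longrightarrow> q \<in> SU2 \<Longrightarrow> p ** q \<in> SU2"
  by (simp add: SU2_iff hconj_mult det_mul) (metis matrix_mul_assoc matrix_mul_lid)

lemma SU2_inner: "q \<in> SU2 \<Longrightarrow> (q ** x) \<bullet> (q ** y) = x \<bullet> y" for x y :: "complex^2^2"
  by (simp add: inner_mult_left matrix_mul_assoc SU2_left)

lemma SU2_mult_left_cancel: "q \<in> SU2 \<Longrightarrow> q ** x = q ** y \<longleftrightarrow> x = y"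
  by (metis SU2_left matrix_mul_assoc matrix_mul_lid)

text \<open>A real linear subspace that contains \<open>SU2\<close>, so velocities of curves in the
  group stay in it. This stands in for differentiating the condition on the determinant.\<close>

definition quaternions :: "(complex^2^2) set" where
  "quaternions = range (\<lambda>(a, b). a *\<^sub>R mat 1 + su b)"

lemma quaternions_iff: "q \<in> quaternions \<longleftrightarrow> q$2$1 = - cnj (q$1$2) \<and> q$2$2 = cnj (q$1$1)"
proof
  assume "q \<in> quaternions"
  then show "q$2$1 = - cnj (q$1$2) \<and> q$2$2 = cnj (q$1$1)"
    by (auto simp: quaternions_def mat2_simps)
next
  assume "q$2$1 = - cnj (q$1$2) \<and> q$2$2 = cnj (q$1$1)"
  then have "q = Re (q$1$1) *\<^sub>R mat 1
      + su (vector [2 * Im (q$1$1), 2 * Re (q$1$2), 2 * Im (q$1$2)])"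
    by (auto simp: mat2_simps)
  then show "q \<in> quaternions"
    unfolding quaternions_def by (intro range_eqI[of _ _ "(_, _)"]) simp
qed

lemma quaternions_mult: "p \<in> quaternions \<Longrightarrow> q \<in> quaternions \<Longrightarrow> p ** q \<in> quaternions"
  by (simp add: quaternions_iff mat2_simps algebra_simps)

lemma quaternions_hconj: "q \<in> quaternions \<Longrightarrow> hconj q \<in> quaternions"
  by (simp add: quaternions_iff hconj_def)

lemma SU2_subset_quaternions: "SU2 \<subseteq> quaternions"
proof
  fix q assume "q \<in> SU2"
  \<comment> \<open>The adjugate of \<open>q\<close>, which is its inverse because the determinant
    is 1; unitarity makes it equal to \<open>hconj q\<close>.\<close>
  define r :: "complex^2^2" where "r = vector [vector [q$2$2, - q$1$2], vector [- q$2$1, q$1$1]]"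
  have "q ** r = mat 1"
    using \<open>q \<in> SU2\<close> by (simp add: SU2_iff det_2 vec_eq_iff forall_2 sum_2 matrix_matrix_mult_def mat_def r_def algebra_simps)
  then have "hconj q = r"
    using SU2_left[OF \<open>q \<in> SU2\<close>] by (metis matrix_mul_assoc matrix_mul_lid matrix_mul_rid)
  then have "cnj (q$1$2) = - q$2$1" "cnj (q$1$1) = q$2$2"
    by (simp_all add: r_def hconj_def vec_eq_iff forall_2)
  then show "q \<in> quaternions"
    by (simp add: quaternions_iff)
qed

text \<open>The one-parameter subgroup \<open>exp (t su a)\<close>; the quotient is \<open>0\<close> for \<open>a = 0\<close>.\<close>

definition su_exp :: "real \<Rightarrow> real^3 \<Rightarrow> complex^2^2" where
  "su_exp t a = cos (t * norm a / 2) *\<^sub>R mat 1 + (2 * sin (t * norm a / 2) / norm a) *\<^sub>R su a"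

lemma su_exp_0 [simp]: "su_exp 0 a = mat 1"
  by (simp add: su_exp_def)

lemma su_exp_comm: "su_exp t a ** su a = su a ** su_exp t a"
  by (simp add: su_exp_def mm.add_left mm.add_right mm.scaleR_left mm.scaleR_right)

text \<open>The square is a negative scalar, so the exponential series sums to a cosine and a sine
  of half the norm: this is the formula for \<open>su_exp\<close>.\<close>

lemma su_mult_self: "su a ** su a = (- (norm a)\<^sup>2 / 4) *\<^sub>R mat 1"
  by (simp add: su_mult_su su_zero dot_square_norm)

lemma has_vector_derivative_su_exp:
  "((\<lambda>t. su_exp t a) has_vector_derivative su_exp t a ** su a) (at t)"
proof -
  have "((\<lambda>t. su_exp t a) has_vector_derivative
      (- sin (t * norm a / 2) * (norm a / 2)) *\<^sub>R mat 1
      + (2 * (cos (t * norm a / 2) * (norm a / 2)) / norm a) *\<^sub>R su a) (at t)"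
  proof -
    have "((\<lambda>t. cos (t * norm a / 2)) has_real_derivative - sin (t * norm a / 2) * (norm a / 2)) (at t)"
      by (auto intro!: derivative_eq_intros)
    moreover have "((\<lambda>t. 2 * sin (t * norm a / 2) / norm a) has_real_derivative
        2 * (cos (t * norm a / 2) * (norm a / 2)) / norm a) (at t)"
      by (cases "a = 0") (auto intro!: derivative_eq_intros)
    ultimately show ?thesis
      unfolding su_exp_def
      using has_vector_derivative_add[OF has_vector_derivative_scaleR[OF _ has_vector_derivative_const]
          has_vector_derivative_scaleR[OF _ has_vector_derivative_const]]
      by fastforce
  qed
  also have "(- sin (t * norm a / 2) * (norm a / 2)) *\<^sub>R mat 1
      + (2 * (cos (t * norm a / 2) * (norm a / 2)) / norm a) *\<^sub>R su a = su_exp t a ** su a"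
    by (cases "a = 0")
      (simp_all add: su_exp_def mm.add_left mm.scaleR_left su_mult_self power2_eq_square su_zero)
  finally show ?thesis .
qed

lemma su_exp_inverse: "su_exp t a ** su_exp (- t) a = mat 1"
proof (cases "a = 0")
  case False
  have "(c *\<^sub>R mat 1 + d *\<^sub>R su a) ** (c *\<^sub>R mat 1 + (- d) *\<^sub>R su a)
      = (c\<^sup>2 + (d * norm a / 2)\<^sup>2) *\<^sub>R mat 1" for c d
    by (simp add: mm.add_left mm.diff_left mm.diff_right mm.scaleR_left mm.scaleR_right
        su_mult_self power2_eq_square algebra_simps)
  from this[of "cos (t * norm a / 2)" "2 * sin (t * norm a / 2) / norm a"] False show ?thesis
    by (simp add: su_exp_def)
qed (simp add: su_exp_def su_zero)

lemma hconj_su_exp: "hconj (su_exp t a) = su_exp (- t) a"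
  by (simp add: su_exp_def hconj_add hconj_scaleR hconj_su hconj_one)

lemma su_exp_in_SU2: "su_exp t a \<in> SU2"
proof -
  have "hconj (su_exp t a) ** su_exp t a = mat 1"
    using su_exp_inverse[of "- t" a] by (simp add: hconj_su_exp)
  \<comment> \<open>For a quaternion \<open>x\<close> the matrix \<open>hconj x ** x\<close> is
    \<open>det x\<close> times the identity, so its corner entry gives the determinant.\<close>
  moreover have "det (su_exp t a) = (hconj (su_exp t a) ** su_exp t a) $ 1 $ 1"
  proof -
    have "det (c *\<^sub>R mat 1 + d *\<^sub>R su a)
        = (hconj (c *\<^sub>R mat 1 + d *\<^sub>R su a) ** (c *\<^sub>R mat 1 + d *\<^sub>R su a)) $ 1 $ 1" for c d
      by (simp add: det_2 mat2_simps algebra_simps)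
    then show ?thesis by (simp add: su_exp_def)
  qed
  ultimately show ?thesis
    by (simp add: SU2_iff mat_def)
qed

section \<open>The cotangent bundle\<close>

text \<open>\<open>D\<close> need not be unique as a derivative within \<open>M\<close>, but its
  value at the velocity of a curve in \<open>M\<close> is the derivative of \<open>f\<close> along
  that curve. All values of derivatives within submanifolds are obtained this way.\<close>

lemma has_vector_derivative_along_curve:
  assumes f: "(f has_derivative D) (at (c t) within M)"
    and c: "\<And>s. c s \<in> M" "(c has_vector_derivative v) (at t)"
  shows "((\<lambda>s. f (c s)) has_vector_derivative D v) (at t)"
proof -
  have "(f has_derivative D) (at (c t) within range c)"
    using f by (rule has_derivative_subset) (use c in auto)
  then have "((\<lambda>s. f (c s)) has_derivative (\<lambda>s. D (s *\<^sub>R v))) (at t)"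
    using has_derivative_in_compose[of c "\<lambda>s. s *\<^sub>R v" t UNIV f D] c(2)
    by (simp add: has_vector_derivative_def)
  moreover have "D (s *\<^sub>R v) = s *\<^sub>R D v" for s
    using f by (simp add: has_derivative_linear linear_scale)
  ultimately show ?thesis
    by (simp add: has_vector_derivative_def)
qed

lemma velocity_in_tangent_space:
  assumes "\<And>s. c s \<in> M" "(c has_vector_derivative v) (at t)"
  shows "v \<in> tangent_space M (c t)"
  unfolding tangent_space_def mem_Collect_eq
proof (intro exI conjI allI)
  have "((\<lambda>s. t + s) has_vector_derivative 1) (at 0)"
    by (auto intro!: derivative_eq_intros)
  then show "((\<lambda>s. c (t + s)) has_vector_derivative v) (at 0)"
    using vector_diff_chain_at[of "\<lambda>s. t + s" 1 0 c v] assms(2) by (simp add: o_def)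
qed (use assms in auto)

lemma has_vector_derivative_mult_su_exp:
  fixes q :: "complex^2^2"
  shows
  "((\<lambda>t. q ** su_exp t a) has_vector_derivative q ** su_exp t a ** su a) (at t)"
  using mm.has_vector_derivative[of "\<lambda>_. q" 0 t UNIV "\<lambda>t. su_exp t a",
      OF _ has_vector_derivative_su_exp]
  by (simp add: mm.zero_left matrix_mul_assoc)

text \<open>A velocity \<open>v\<close> is a quaternion, since linear equations pass to derivatives,
  and so is \<open>hconj q ** v\<close>. Differentiating unitarity kills the scalar part of the
  latter, which leaves an element of su(2). Conversely \<open>su_exp\<close> supplies the
  curves.\<close>

lemma tangent_space_SU2:
  assumes "q \<in> SU2"
  shows "tangent_space SU2 q = range (\<lambda>a. q ** su a)"
proof safe
  fix v assume "v \<in> tangent_space SU2 q"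
  then obtain c where c: "\<And>t. c t \<in> SU2" "c 0 = q" "(c has_vector_derivative v) (at 0)"
    unfolding tangent_space_def by auto
  have zero: "f v = 0" if "bounded_linear f" "\<And>x. x \<in> quaternions \<Longrightarrow> f x = 0" for f :: "complex^2^2 \<Rightarrow> complex"
  proof -
    have "f (c t) = 0" for t
      using that(2) c(1) SU2_subset_quaternions by blast
    then show ?thesis
      using bounded_linear.has_vector_derivative[OF that(1) c(3)]
        vector_derivative_unique_at[OF has_vector_derivative_const] by fastforce
  qed
  have "v$2$1 + cnj (v$1$2) = 0"
    by (rule zero)
      (auto simp: quaternions_iff algebra_simps linear_conv_bounded_linear[symmetric] intro!: linearI)
  moreover have "v$2$2 - cnj (v$1$1) = 0"
    by (rule zero)
      (auto simp: quaternions_iff algebra_simps linear_conv_bounded_linear[symmetric] intro!: linearI)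
  ultimately have "v \<in> quaternions"
    by (simp add: quaternions_iff add_eq_0_iff)
  then have "hconj q ** v \<in> quaternions"
    using assms SU2_subset_quaternions by (blast intro: quaternions_mult quaternions_hconj)
  then obtain a b where ab: "hconj q ** v = a *\<^sub>R mat 1 + su b"
    by (auto simp: quaternions_def)
  have "((\<lambda>t. hconj (c t) ** c t) has_vector_derivative hconj q ** v + hconj v ** q) (at 0)"
    using mm.has_vector_derivative[OF bounded_linear.has_vector_derivative[OF bounded_linear_hconj c(3)] c(3)]
    by (simp add: c(2))
  then have "hconj q ** v + hconj v ** q = 0"
    using c(1) vector_derivative_unique_at[OF has_vector_derivative_const] by (simp add: SU2_left) blast
  moreover have "hconj v ** q = hconj (hconj q ** v)"
    by (simp add: hconj_mult) (simp add: hconj_def vec_eq_iff)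
  ultimately have "(2 * a) *\<^sub>R mat 1 + su 0 = 0"
    by (simp add: ab hconj_add hconj_scaleR hconj_su hconj_one su_zero algebra_simps flip: scaleR_add_left)
  then have "hconj q ** v = su b"
    unfolding one_su_indep by (simp add: ab)
  then have "v = q ** su b"
    using SU2_right[OF assms] by (metis matrix_mul_assoc matrix_mul_lid)
  then show "v \<in> range (\<lambda>a. q ** su a)" by blast
next
  fix a
  have "((\<lambda>t. q ** su_exp t a) has_vector_derivative q ** su a) (at 0)"
    using has_vector_derivative_mult_su_exp[of q a 0] by simp
  then show "q ** su a \<in> tangent_space SU2 q"
    using velocity_in_tangent_space[of "\<lambda>t. q ** su_exp t a" SU2 "q ** su a" 0]
      SU2_mult[OF assms su_exp_in_SU2] by simp
qed

text \<open>
  The covector at \<open>q\<close> with values \<open>h\<close> on the frame \<open>q X\<^sub>i\<close>; the factor is \<open>2\<close> as \<open>q X\<^sub>i\<close> has norm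
  \<open>1 / sqrt 2\<close>.
\<close>

definition covector :: "complex^2^2 \<Rightarrow> real^3 \<Rightarrow> (complex^2^2) \<Rightarrow>\<^sub>L real" where
  "covector v h = blinfun_inner_right (2 *\<^sub>R (v ** su h))"

definition momentum :: "complex^2^2 \<Rightarrow> ((complex^2^2) \<Rightarrow>\<^sub>L real) \<Rightarrow> real^3" where
  "momentum q p = (\<Sum>b\<in>Basis. blinfun_apply p (q ** su b) *\<^sub>R b)"

lemma covector_apply [simp]: "blinfun_apply (covector v h) w = 2 * ((v ** su h) \<bullet> w)"
  by (simp add: covector_def)

lemma bounded_linear_comp_bounded_bilinear:
  assumes "bounded_linear f" "bounded_bilinear g"
  shows "bounded_bilinear (\<lambda>x y. f (g x y))"
proof -
  interpret f: bounded_linear f by fact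
  interpret g: bounded_bilinear g by fact
  obtain K where K: "\<And>z. norm (f z) \<le> norm z * K" "K > 0" using f.pos_bounded by blast
  obtain L where L: "\<And>x y. norm (g x y) \<le> norm x * norm y * L" using g.bounded by blast
  show ?thesis
  proof
    have "norm (f (g x y)) \<le> norm x * norm y * (L * K)" for x y
      using order_trans[OF K(1) mult_right_mono[OF L less_imp_le[OF K(2)]]] by (simp add: mult.assoc)
    then show "\<exists>K. \<forall>x y. norm (f (g x y)) \<le> norm x * norm y * K" by blast
  qed (simp_all add: g.add_left g.add_right g.scaleR_left g.scaleR_right f.add f.scaleR)
qed

lemma bounded_bilinear_covector: "bounded_bilinear covector"
  unfolding covector_def[abs_def]
  by (intro bounded_linear_comp_bounded_bilinear[OF bounded_linear_blinfun_inner_right]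
      bounded_linear_comp_bounded_bilinear[OF bounded_linear_scaleR_right]
      mm.comp[OF bounded_linear_ident bounded_linear_su])

interpretation covector: bounded_bilinear covector
  by (rule bounded_bilinear_covector)

lemma bounded_bilinear_momentum: "bounded_bilinear momentum"
proof
  obtain K where K: "\<And>(x :: complex^2^2) (y :: complex^2^2). norm (x ** y) \<le> norm x * norm y * K"
    using mm.bounded by blast
  have "norm (momentum q p) \<le> norm q * norm p * (\<Sum>b\<in>Basis. norm (su b) * K)" for q p
    unfolding momentum_def sum_distrib_left
  proof (rule order_trans[OF norm_sum sum_mono])
    fix b :: "real^3" assume "b \<in> Basis"
    then have "norm (blinfun_apply p (q ** su b) *\<^sub>R b) = norm (blinfun_apply p (q ** su b))"
      by simp
    also have "\<dots> \<le> norm p * norm (q ** su b)"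
      by (rule norm_blinfun)
    also have "\<dots> \<le> norm p * (norm q * norm (su b) * K)"
      using K by (intro mult_left_mono) auto
    finally show "norm (blinfun_apply p (q ** su b) *\<^sub>R b) \<le> norm q * norm p * (norm (su b) * K)"
      by (simp add: mult_ac)
  qed
  then show "\<exists>K. \<forall>q p. norm (momentum q p) \<le> norm q * norm p * K" by blast
qed (simp_all add: momentum_def mm.add_left mm.scaleR_left blinfun.add_right blinfun.add_left
    blinfun.scaleR_right blinfun.scaleR_left scaleR_add_left sum.distrib scaleR_sum_right)

interpretation momentum: bounded_bilinear momentum
  by (rule bounded_bilinear_momentum)

lemma inner_momentum: "momentum q p \<bullet> k = blinfun_apply p (q ** su k)"
proof -
  have "linear (\<lambda>k. blinfun_apply p (q ** su k))"
    by (auto intro!: linearI simp: su_add su_scaleR mm.add_right mm.scaleR_right blinfun.add_right blinfun.scaleR_right)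
  then have "blinfun_apply p (q ** su (\<Sum>b\<in>Basis. (k \<bullet> b) *\<^sub>R b)) = (\<Sum>b\<in>Basis. (k \<bullet> b) *\<^sub>R blinfun_apply p (q ** su b))"
    by (simp add: linear_sum[OF \<open>linear _\<close>] linear_scale[OF \<open>linear _\<close>, simplified])
  then have "blinfun_apply p (q ** su k) = (\<Sum>b\<in>Basis. (k \<bullet> b) * blinfun_apply p (q ** su b))"
    by (simp only: euclidean_representation real_scaleR_def)
  then show ?thesis
    by (simp add: momentum_def inner_sum_left inner_commute[of k] mult.commute)
qed

lemma momentum_covector: "q \<in> SU2 \<Longrightarrow> momentum q (covector q h) = h"
  by (simp add: inner_momentum SU2_inner inner_su_su flip: vector_eq_rdot[of "momentum q (covector q h)"])

lemma cotangent_space_SU2: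
  assumes "q \<in> SU2"
  shows "cotangent_space SU2 q = range (covector q)"
proof safe
  fix p assume p: "p \<in> cotangent_space SU2 q"
  have "p = covector q (momentum q p)"
  proof (rule blinfun_eqI)
    fix w
    \<comment> \<open>\<open>2 *\<^sub>R (q ** su k)\<close> is the orthogonal projection of
      \<open>w\<close> to the tangent space, and \<open>p\<close> vanishes on the remainder.\<close>
    define k where "k = momentum q (blinfun_inner_right w)"
    have "(w - 2 *\<^sub>R (q ** su k)) \<bullet> (q ** su a) = 0" for a
      using inner_momentum[of q "blinfun_inner_right w" a] assms
      by (simp add: inner_diff_left SU2_inner inner_su_su k_def)
    then have "blinfun_apply p (w - 2 *\<^sub>R (q ** su k)) = 0"
      using p unfolding cotangent_space_def tangent_space_SU2[OF assms] by blast
    then have "blinfun_apply p w = 2 * (momentum q p \<bullet> k)"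
      by (simp add: blinfun.diff_right blinfun.scaleR_right inner_momentum)
    also have "\<dots> = 2 * (k \<bullet> momentum q p)"
      by (simp add: inner_commute)
    also have "\<dots> = blinfun_apply (covector q (momentum q p)) w"
      unfolding k_def inner_momentum by (simp add: inner_commute)
    finally show "blinfun_apply p w = blinfun_apply (covector q (momentum q p)) w" .
  qed
  then show "p \<in> range (covector q)" by blast
next
  fix h show "covector q h \<in> cotangent_space SU2 q"
    by (auto simp: cotangent_space_def tangent_space_SU2[OF assms] inner_commute)
qed

lemma cotangent_bundle_SU2: "z \<in> cotangent_bundle SU2 \<longleftrightarrow> (\<exists>q\<in>SU2. \<exists>h. z = (q, covector q h))"
  by (auto simp: cotangent_bundle_def cotangent_space_SU2)

lemma covector_momentum: "(q, p) \<in> cotangent_bundle SU2 \<Longrightarrow> covector q (momentum q p) = p"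
  by (auto simp: cotangent_bundle_SU2 momentum_covector)

text \<open>Splits a velocity into its base part \<open>a\<close> and the velocity \<open>k\<close>
  of the momentum. It serves to find the tangent space of the bundle and, later, to read Hamilton's
  equations off an arbitrary integral curve.\<close>

lemma velocity_cotangent_bundle:
  assumes \<gamma>: "\<And>s. \<gamma> s \<in> cotangent_bundle SU2" "(\<gamma> has_vector_derivative Z) (at t)" "\<gamma> t = (q, covector q h)"
  obtains a k where "Z = (q ** su a, covector (q ** su a) h + covector q k)"
    and "((\<lambda>s. momentum (fst (\<gamma> s)) (snd (\<gamma> s))) has_vector_derivative k) (at t)"
proof -
  have fst: "((\<lambda>s. fst (\<gamma> s)) has_vector_derivative fst Z) (at t)"
    by (rule bounded_linear.has_vector_derivative[OF bounded_linear_fst \<gamma>(2)])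
  have snd: "((\<lambda>s. snd (\<gamma> s)) has_vector_derivative snd Z) (at t)"
    by (rule bounded_linear.has_vector_derivative[OF bounded_linear_snd \<gamma>(2)])
  have SU2: "fst (\<gamma> s) \<in> SU2" for s
    using \<gamma>(1)[of s] by (auto simp: cotangent_bundle_def)
  then have "fst Z \<in> tangent_space SU2 (fst (\<gamma> t))"
    by (rule velocity_in_tangent_space[where c = "\<lambda>s. fst (\<gamma> s)", OF _ fst])
  moreover have "q \<in> SU2" using SU2[of t] \<gamma>(3) by simp
  ultimately obtain a where a: "fst Z = q ** su a"
    using \<gamma>(3) by (auto simp: tangent_space_SU2)
  obtain k where k: "((\<lambda>s. momentum (fst (\<gamma> s)) (snd (\<gamma> s))) has_vector_derivative k) (at t)"
    using momentum.has_vector_derivative[OF fst snd] by blast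
  have "covector (fst (\<gamma> s)) (momentum (fst (\<gamma> s)) (snd (\<gamma> s))) = snd (\<gamma> s)" for s
    using \<gamma>(1)[of s] by (simp add: covector_momentum)
  then have "snd Z = covector (fst (\<gamma> t)) k + covector (fst Z) (momentum (fst (\<gamma> t)) (snd (\<gamma> t)))"
    using covector.has_vector_derivative[OF fst k] snd by (simp add: vector_derivative_unique_at)
  then have "snd Z = covector (q ** su a) h + covector q k"
    using \<open>q \<in> SU2\<close> by (simp add: \<gamma>(3) a momentum_covector)
  with a k show ?thesis
    by (intro that[of a k]) (auto simp: prod_eq_iff)
qed

lemma curve_in_cotangent_bundle:
  fixes a h k :: "real^3"
  assumes "q \<in> SU2"
  shows "(q ** su_exp t a, covector (q ** su_exp t a) (h + t *\<^sub>R k)) \<in> cotangent_bundle SU2"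
    and "((\<lambda>t. (q ** su_exp t a, covector (q ** su_exp t a) (h + t *\<^sub>R k))) has_vector_derivative
      (q ** su a, covector (q ** su a) h + covector q k)) (at 0)"
proof -
  have "q ** su_exp s a \<in> SU2" for s
    using assms SU2_mult su_exp_in_SU2 by blast
  then show "(q ** su_exp t a, covector (q ** su_exp t a) (h + t *\<^sub>R k)) \<in> cotangent_bundle SU2"
    unfolding cotangent_bundle_SU2 by blast
  have 1: "((\<lambda>t. q ** su_exp t a) has_vector_derivative q ** su a) (at 0)"
    using has_vector_derivative_mult_su_exp[of q a 0] by simp
  have 2: "((\<lambda>t. h + t *\<^sub>R k) has_vector_derivative k) (at 0)"
    by (auto intro!: derivative_eq_intros)
  show "((\<lambda>t. (q ** su_exp t a, covector (q ** su_exp t a) (h + t *\<^sub>R k))) has_vector_derivative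
      (q ** su a, covector (q ** su a) h + covector q k)) (at 0)"
    using has_vector_derivative_Pair[OF 1 covector.has_vector_derivative[OF 1 2]]
    by (simp add: add.commute)
qed

lemma tangent_space_cotangent_bundle_SU2:
  assumes "q \<in> SU2"
  shows "tangent_space (cotangent_bundle SU2) (q, covector q h)
    = range (\<lambda>(a, k). (q ** su a, covector (q ** su a) h + covector q k))"
proof safe
  fix v p assume "(v, p) \<in> tangent_space (cotangent_bundle SU2) (q, covector q h)"
  then obtain \<gamma> where "\<And>s. \<gamma> s \<in> cotangent_bundle SU2" "\<gamma> 0 = (q, covector q h)"
      "(\<gamma> has_vector_derivative (v, p)) (at 0)"
    unfolding tangent_space_def by auto
  then obtain a k where "(v, p) = (q ** su a, covector (q ** su a) h + covector q k)"
    using velocity_cotangent_bundle[of \<gamma> "(v, p)" 0 q h] by blast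
  then show "(v, p) \<in> range (\<lambda>(a, k). (q ** su a, covector (q ** su a) h + covector q k))"
    by (intro range_eqI[of _ _ "(a, k)"]) simp
next
  fix a k
  show "(q ** su a, covector (q ** su a) h + covector q k) \<in> tangent_space (cotangent_bundle SU2) (q, covector q h)"
    using velocity_in_tangent_space[OF curve_in_cotangent_bundle[OF assms, where a = a and h = h and k = k]] by simp
qed

section \<open>The Hamiltonian flow\<close>

text \<open>The gradient of the Hamiltonian in the coordinates \<open>h\<close>, and also the
  left-trivialised velocity of the geodesic.\<close>

definition horizontal :: "real^3 \<Rightarrow> real^3" where
  "horizontal h = h - h$1 *\<^sub>R axis 1 1"

lemma horizontal_nth [simp]: "horizontal h $ 1 = 0" "horizontal h $ 2 = h $ 2" "horizontal h $ 3 = h $ 3"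
  by (simp_all add: horizontal_def axis_def)

lemma SU2_hamiltonian_eq: "SU2_hamiltonian (q, p) = 1/2 * ((momentum q p $ 2)\<^sup>2 + (momentum q p $ 3)\<^sup>2)"
proof -
  have "(1/2) *\<^sub>R vector [vector [0, 1], vector [- 1, 0]] = su (axis 2 1)"
    "(1/2) *\<^sub>R vector [vector [0, \<i>], vector [\<i>, 0]] = su (axis 3 1)"
    by (simp_all add: mat2_simps axis_def)
  then have "X1 q = q ** su (axis 2 1)" "X2 q = q ** su (axis 3 1)"
    by (simp_all add: X1_def X2_def)
  then show ?thesis
    by (simp add: SU2_hamiltonian_def inner_axis flip: inner_momentum)
qed

lemma SU2_hamiltonian_differentiable: "SU2_hamiltonian differentiable (at z)"
proof -
  have "((\<lambda>z. momentum (fst z) (snd z)) has_derivative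
      (\<lambda>y. momentum (fst z) (snd y) + momentum (fst y) (snd z))) (at z)"
    by (rule momentum.FDERIV) (auto intro!: derivative_eq_intros)
  then have "(\<lambda>z. momentum (fst z) (snd z) $ i) differentiable (at z)" for i
    using bounded_linear.has_derivative[OF bounded_linear_vec_nth] differentiableI by blast
  then have "(\<lambda>z. 1/2 * ((momentum (fst z) (snd z) $ 2)\<^sup>2 + (momentum (fst z) (snd z) $ 3)\<^sup>2)) differentiable (at z)"
    by (intro differentiable_mult differentiable_add differentiable_power differentiable_const)
  moreover have "SU2_hamiltonian
      = (\<lambda>z. 1/2 * ((momentum (fst z) (snd z) $ 2)\<^sup>2 + (momentum (fst z) (snd z) $ 3)\<^sup>2))"
    by (auto simp: fun_eq_iff SU2_hamiltonian_eq)
  ultimately show ?thesis by simp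
qed

text \<open>By left invariance the Hamiltonian depends on the momentum alone, so the base direction
  \<open>b\<close> contributes nothing.\<close>

lemma frechet_derivative_SU2_hamiltonian:
  assumes "q \<in> SU2"
  shows "frechet_derivative SU2_hamiltonian (at (q, covector q h) within cotangent_bundle SU2)
    (q ** su b, covector (q ** su b) h + covector q l) = horizontal h \<bullet> l"
proof -
  let ?D = "frechet_derivative SU2_hamiltonian (at (q, covector q h) within cotangent_bundle SU2)"
  let ?Y = "(q ** su b, covector (q ** su b) h + covector q l)"
  define \<gamma> where "\<gamma> t = (q ** su_exp t b, covector (q ** su_exp t b) (h + t *\<^sub>R l))" for t
  have \<gamma>: "\<gamma> t \<in> cotangent_bundle SU2" "(\<gamma> has_vector_derivative ?Y) (at 0)" for t
    unfolding \<gamma>_def using curve_in_cotangent_bundle[OF assms] by auto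
  have "(SU2_hamiltonian has_derivative ?D) (at (\<gamma> 0) within cotangent_bundle SU2)"
    using differentiable_at_withinI[OF SU2_hamiltonian_differentiable]
    by (simp add: frechet_derivative_works \<gamma>_def)
  then have "((\<lambda>t. SU2_hamiltonian (\<gamma> t)) has_vector_derivative ?D ?Y) (at 0)"
    by (rule has_vector_derivative_along_curve[where c = \<gamma> and t = 0, OF _ \<gamma>])
  moreover have "SU2_hamiltonian (\<gamma> t)
      = 1/2 * ((h $ 2 + t * l $ 2) * (h $ 2 + t * l $ 2) + (h $ 3 + t * l $ 3) * (h $ 3 + t * l $ 3))" for t
    unfolding \<gamma>_def
    by (simp add: SU2_hamiltonian_eq momentum_covector SU2_mult assms su_exp_in_SU2 power2_eq_square)
  moreover have "((\<lambda>t. 1/2 * ((h $ 2 + t * l $ 2) * (h $ 2 + t * l $ 2) + (h $ 3 + t * l $ 3) * (h $ 3 + t * l $ 3)))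
      has_vector_derivative horizontal h \<bullet> l) (at 0)"
    unfolding has_real_derivative_iff_has_vector_derivative[symmetric]
    by (auto intro!: derivative_eq_intros simp: inner_vec_def sum_3 algebra_simps)
  ultimately show ?thesis
    using vector_derivative_unique_at by force
qed

text \<open>The canonical pairing plus \<open>h \<bullet> cross3 a b\<close>, the momentum evaluated
  on the Lie bracket, because a left-invariant frame does not commute. The two halves come from
  \<open>su_mult_su\<close>.\<close>

lemma symplectic_form_left_trivialised:
  assumes "q \<in> SU2"
  shows "symplectic_form (q ** su b, covector (q ** su b) h + covector q l) (q ** su a, covector (q ** su a) h + covector q k)
    = b \<bullet> cross3 h a + l \<bullet> a - k \<bullet> b"
proof -
  have "symplectic_form (q ** su b, covector (q ** su b) h + covector q l) (q ** su a, covector (q ** su a) h + covector q k)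
      = (cross3 b h \<bullet> a) / 2 + l \<bullet> a - ((cross3 a h \<bullet> b) / 2 + k \<bullet> b)"
    using assms by (simp add: symplectic_form_def blinfun.add_left su_mult_su inner_add_left
        inner_diff_left inner_one_su inner_su_su SU2_inner flip: matrix_mul_assoc)
  moreover have "cross3 b h \<bullet> a = b \<bullet> cross3 h a" "cross3 a h \<bullet> b = - (b \<bullet> cross3 h a)"
    by (simp_all add: cross3_simps)
  ultimately show ?thesis by simp
qed

text \<open>Testing with \<open>b = 0\<close> forces the base part, testing with
  \<open>l = 0\<close> the fibre part; this is the uniqueness that the definite description asks
  for. The fibre part is the Euler equation on the dual of su(2).\<close>

lemma hamiltonian_vector_field_SU2:
  assumes "q \<in> SU2"
  shows "hamiltonian_vector_field SU2 SU2_hamiltonian (q, covector q h)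
    = (q ** su (horizontal h), covector (q ** su (horizontal h)) h + covector q (cross3 h (horizontal h)))"
  unfolding hamiltonian_vector_field_def
proof (rule the_equality)
  show "(q ** su (horizontal h), covector (q ** su (horizontal h)) h + covector q (cross3 h (horizontal h)))
      \<in> tangent_space (cotangent_bundle SU2) (q, covector q h) \<and>
    (\<forall>Y\<in>tangent_space (cotangent_bundle SU2) (q, covector q h).
      symplectic_form Y (q ** su (horizontal h), covector (q ** su (horizontal h)) h + covector q (cross3 h (horizontal h)))
      = frechet_derivative SU2_hamiltonian (at (q, covector q h) within cotangent_bundle SU2) Y)"
    unfolding tangent_space_cotangent_bundle_SU2[OF assms]
  proof (intro conjI ballI)
    show "(q ** su (horizontal h), covector (q ** su (horizontal h)) h + covector q (cross3 h (horizontal h)))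
        \<in> range (\<lambda>(a, k). (q ** su a, covector (q ** su a) h + covector q k))"
      by (intro range_eqI[of _ _ "(_, _)"]) simp
  next
    fix Y assume "Y \<in> range (\<lambda>(a, k). (q ** su a, covector (q ** su a) h + covector q k))"
    then obtain b l where Y: "Y = (q ** su b, covector (q ** su b) h + covector q l)" by auto
    show "symplectic_form Y (q ** su (horizontal h), covector (q ** su (horizontal h)) h + covector q (cross3 h (horizontal h)))
      = frechet_derivative SU2_hamiltonian (at (q, covector q h) within cotangent_bundle SU2) Y"
      unfolding Y symplectic_form_left_trivialised[OF assms] frechet_derivative_SU2_hamiltonian[OF assms]
      by (simp add: inner_commute[of b] inner_commute[of l])
  qed
next
  fix X assume X: "X \<in> tangent_space (cotangent_bundle SU2) (q, covector q h) \<and>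
    (\<forall>Y\<in>tangent_space (cotangent_bundle SU2) (q, covector q h).
      symplectic_form Y X = frechet_derivative SU2_hamiltonian (at (q, covector q h) within cotangent_bundle SU2) Y)"
  then obtain a k where ak: "X = (q ** su a, covector (q ** su a) h + covector q k)"
    unfolding tangent_space_cotangent_bundle_SU2[OF assms] by auto
  have eq: "b \<bullet> cross3 h a + l \<bullet> a - k \<bullet> b = horizontal h \<bullet> l" for b l
  proof -
    have "(q ** su b, covector (q ** su b) h + covector q l) \<in> tangent_space (cotangent_bundle SU2) (q, covector q h)"
      unfolding tangent_space_cotangent_bundle_SU2[OF assms]
      by (intro range_eqI[of _ _ "(b, l)"]) simp
    with X show ?thesis
      unfolding ak using symplectic_form_left_trivialised[OF assms, of b h l a k]
        frechet_derivative_SU2_hamiltonian[OF assms, of h b l] by metis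
  qed
  have "a \<bullet> l = horizontal h \<bullet> l" for l
    using eq[of 0 l] inner_commute[of a l] by simp
  moreover have "cross3 h a \<bullet> b = k \<bullet> b" for b
    using eq[of b 0] inner_commute[of b "cross3 h a"] by simp
  ultimately have "a = horizontal h" "cross3 h a = k"
    using vector_eq_rdot by blast+
  then show "X = (q ** su (horizontal h), covector (q ** su (horizontal h)) h + covector q (cross3 h (horizontal h)))"
    by (simp add: ak)
qed

section \<open>Explicit solution of Hamilton's equations\<close>

lemma su_exp_minus: "su_exp (- t) a = su_exp t (- a)"
  by (simp add: su_exp_def su_minus)

lemma su_commutator: "su a ** su b - su b ** su a = su (cross3 a b)"
proof -
  have "su a ** su b - su b ** su a = (1/2) *\<^sub>R su (cross3 a b) + (1/2) *\<^sub>R su (cross3 a b)"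
    by (simp add: su_mult_su inner_commute cross_skew[of b a] su_minus)
  then show ?thesis
    by (simp flip: scaleR_add_left)
qed

text \<open>
  As \<open>v\<close> is constant along the motion, the equation reads \<open>\<eta>' = - \<eta> \<times> v\<close>, and conjugating \<open>su \<eta>\<close> by
  \<open>exp (t su v)\<close> makes it constant.
\<close>

lemma momentum_equation_solution:
  assumes "\<And>t. (\<eta> has_vector_derivative cross3 (\<eta> t) (horizontal (\<eta> t))) (at t)"
  defines "v \<equiv> \<eta> 0 $ 1 *\<^sub>R axis 1 1"
  shows "horizontal (\<eta> t) = \<eta> t - v"
    and "su (\<eta> 0) ** su_exp (- t) v = su_exp (- t) v ** su (\<eta> t)"
proof -
  have "((\<lambda>t. \<eta> t $ 1) has_vector_derivative 0) (at t)" for t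
    using bounded_linear.has_vector_derivative[OF bounded_linear_vec_nth assms(1), of 1 t]
    by (simp add: cross3_def)
  then obtain c where "\<eta> t $ 1 = c" for t
    using has_vector_derivative_zero_constant[OF convex_UNIV, of "\<lambda>t. \<eta> t $ 1"] by auto
  then have horizontal: "horizontal (\<eta> t) = \<eta> t - v" for t
    by (simp add: horizontal_def v_def)
  then show "horizontal (\<eta> t) = \<eta> t - v" .
  define N where "N t = su_exp (- t) v ** su (\<eta> t) ** su_exp t v" for t
  have "(N has_vector_derivative 0) (at t)" for t
  proof -
    let ?A = "su_exp (- t) v" and ?B = "su_exp t v"
    have A: "((\<lambda>t. su_exp (- t) v) has_vector_derivative - (?A ** su v)) (at t)"
      using has_vector_derivative_su_exp[of "- v" t]
      by (simp add: su_exp_minus su_minus mm.minus_right)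
    have S: "((\<lambda>t. su (\<eta> t)) has_vector_derivative - (su (\<eta> t) ** su v - su v ** su (\<eta> t))) (at t)"
      using bounded_linear.has_vector_derivative[OF bounded_linear_su assms(1), of t]
      by (simp add: horizontal Cross3.right_diff_distrib su_minus su_commutator)
    have "(N has_vector_derivative
        (?A ** su (\<eta> t)) ** (?B ** su v)
        + (?A ** (- (su (\<eta> t) ** su v - su v ** su (\<eta> t))) + (- (?A ** su v)) ** su (\<eta> t)) ** ?B) (at t)"
      unfolding N_def
      by (rule mm.has_vector_derivative[OF mm.has_vector_derivative[OF A S] has_vector_derivative_su_exp])
    moreover have "(?A ** su (\<eta> t)) ** (?B ** su v)
        + (?A ** (- (su (\<eta> t) ** su v - su v ** su (\<eta> t))) + (- (?A ** su v)) ** su (\<eta> t)) ** ?B = 0"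
      by (simp add: su_exp_comm matrix_mul_assoc mm.minus_right mm.minus_left mm.diff_right
          mm.add_left mm.diff_left)
    ultimately show ?thesis by simp
  qed
  then obtain C where "N t = C" for t
    using has_vector_derivative_zero_constant[OF convex_UNIV, of N] by auto
  then have "N t = N 0" by simp
  then have "N t ** su_exp (- t) v = su (\<eta> 0) ** su_exp (- t) v"
    by (simp add: N_def)
  then show "su (\<eta> 0) ** su_exp (- t) v = su_exp (- t) v ** su (\<eta> t)"
    by (simp add: N_def su_exp_inverse flip: matrix_mul_assoc)
qed

text \<open>Both solutions satisfy the same conjugation relation with the same initial value, and
  there the group element cancels.\<close>

lemma momentum_equation_unique:
  assumes "\<And>t. (\<eta> has_vector_derivative cross3 (\<eta> t) (horizontal (\<eta> t))) (at t)"
    and "\<And>t. (\<eta>' has_vector_derivative cross3 (\<eta>' t) (horizontal (\<eta>' t))) (at t)" and "\<eta> 0 = \<eta>' 0"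
  shows "\<eta> t = \<eta>' t"
proof -
  let ?v = "\<eta> 0 $ 1 *\<^sub>R axis 1 1"
  have "su_exp (- t) ?v ** su (\<eta> t) = su_exp (- t) ?v ** su (\<eta>' t)"
    using momentum_equation_solution(2)[OF assms(1), of t] momentum_equation_solution(2)[OF assms(2), of t] assms(3)
    by simp
  then show ?thesis
    by (simp add: SU2_mult_left_cancel su_exp_in_SU2 su_eq_iff)
qed

lemma momentum_equation_exists:
  obtains \<eta> where "\<And>t. (\<eta> has_vector_derivative cross3 (\<eta> t) (horizontal (\<eta> t))) (at t)" "\<eta> 0 = h"
proof
  \<comment> \<open>The pair of horizontal components is rotated by the angle
    \<open>h$1 * t\<close>.\<close>
  let ?\<eta> = "\<lambda>t. h$1 *\<^sub>R axis 1 1 + (cos (h$1 * t) * h$2 - sin (h$1 * t) * h$3) *\<^sub>R axis 2 1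
    + (sin (h$1 * t) * h$2 + cos (h$1 * t) * h$3) *\<^sub>R axis 3 1 :: real^3"
  show "?\<eta> 0 = h"
    by (simp add: vec_eq_iff forall_3 axis_def)
  show "(?\<eta> has_vector_derivative cross3 (?\<eta> t) (horizontal (?\<eta> t))) (at t)" for t
  proof -
    have "((\<lambda>t. cos (h$1 * t) * h$2 - sin (h$1 * t) * h$3) has_real_derivative
        - h$1 * (sin (h$1 * t) * h$2 + cos (h$1 * t) * h$3)) (at t)" (is "(?f has_real_derivative ?f') _")
      by (auto intro!: derivative_eq_intros simp: algebra_simps)
    moreover have "((\<lambda>t. sin (h$1 * t) * h$2 + cos (h$1 * t) * h$3) has_real_derivative
        h$1 * (cos (h$1 * t) * h$2 - sin (h$1 * t) * h$3)) (at t)" (is "(?g has_real_derivative ?g') _")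
      by (auto intro!: derivative_eq_intros simp: algebra_simps)
    ultimately have "(?\<eta> has_vector_derivative (?f' *\<^sub>R axis 2 1 + ?g' *\<^sub>R axis 3 1)) (at t)"
      by (auto intro!: derivative_eq_intros simp: vec_eq_iff forall_3 axis_def algebra_simps)
    moreover have "?f' *\<^sub>R axis 2 1 + ?g' *\<^sub>R axis 3 1 = cross3 (?\<eta> t) (horizontal (?\<eta> t))"
      by (simp add: vec_eq_iff forall_3 axis_def cross3_def)
    ultimately show ?thesis by simp
  qed
qed

definition geodesic :: "complex^2^2 \<Rightarrow> real^3 \<Rightarrow> real \<Rightarrow> complex^2^2" where
  "geodesic q h t = q ** su_exp t h ** su_exp (- t) (h$1 *\<^sub>R axis 1 1)"

lemma geodesic_in_SU2: "q \<in> SU2 \<Longrightarrow> geodesic q h t \<in> SU2"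
  by (simp add: geodesic_def SU2_mult su_exp_in_SU2)

text \<open>The product rule puts \<open>su (\<eta> 0)\<close> in front of the last factor. The
  conjugation relation moves it across as \<open>su (\<eta> t)\<close>, and subtracting the constant
  axis part leaves the horizontal one.\<close>

lemma has_vector_derivative_geodesic:
  assumes "\<And>t. (\<eta> has_vector_derivative cross3 (\<eta> t) (horizontal (\<eta> t))) (at t)"
  shows "(geodesic q (\<eta> 0) has_vector_derivative geodesic q (\<eta> 0) t ** su (horizontal (\<eta> t))) (at t)"
proof -
  let ?h = "\<eta> 0" and ?v = "\<eta> 0 $ 1 *\<^sub>R axis 1 1"
  have R: "((\<lambda>t. su_exp (- t) ?v) has_vector_derivative - (su_exp (- t) ?v ** su ?v)) (at t)"
    using has_vector_derivative_su_exp[of "- ?v" t]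
    by (simp add: su_exp_minus su_minus mm.minus_right)
  have "(geodesic q ?h has_vector_derivative
      (q ** su_exp t ?h) ** (- (su_exp (- t) ?v ** su ?v))
      + (q ** su_exp t ?h ** su ?h) ** su_exp (- t) ?v) (at t)"
    unfolding geodesic_def by (rule mm.has_vector_derivative[OF has_vector_derivative_mult_su_exp R])
  moreover have "(q ** su_exp t ?h) ** (- (su_exp (- t) ?v ** su ?v))
      + (q ** su_exp t ?h ** su ?h) ** su_exp (- t) ?v
      = (q ** su_exp t ?h) ** (su ?h ** su_exp (- t) ?v - su_exp (- t) ?v ** su ?v)"
    by (simp add: mm.diff_right mm.minus_right matrix_mul_assoc)
  moreover have "su ?h ** su_exp (- t) ?v - su_exp (- t) ?v ** su ?v = su_exp (- t) ?v ** su (horizontal (\<eta> t))"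
    using momentum_equation_solution[OF assms, of t] by (simp add: su_diff mm.diff_right)
  ultimately show ?thesis
    by (simp add: geodesic_def matrix_mul_assoc)
qed

lemma geodesic_unique:
  assumes \<eta>: "\<And>t. (\<eta> has_vector_derivative cross3 (\<eta> t) (horizontal (\<eta> t))) (at t)"
    and x: "\<And>t. (x has_vector_derivative x t ** su (horizontal (\<eta> t))) (at t)"
  shows "x t = geodesic (x 0) (\<eta> 0) t"
proof -
  let ?h = "\<eta> 0" and ?v = "\<eta> 0 $ 1 *\<^sub>R axis 1 1"
  \<comment> \<open>\<open>x t\<close> times the inverse of the claimed solution that starts at the
    identity; its constancy is the claim.\<close>
  define N where "N t = x t ** su_exp t ?v ** su_exp (- t) ?h" for t
  have "(N has_vector_derivative 0) (at t)" for t
  proof -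
    let ?A = "su_exp t ?v" and ?B = "su_exp (- t) ?h"
    have B: "((\<lambda>t. su_exp (- t) ?h) has_vector_derivative - (su ?h ** ?B)) (at t)"
      using has_vector_derivative_su_exp[of "- ?h" t] su_exp_comm[of t "- ?h"]
      by (simp add: su_exp_minus su_minus mm.minus_right mm.minus_left)
    have "(N has_vector_derivative (x t ** ?A) ** (- (su ?h ** ?B))
        + (x t ** (?A ** su ?v) + (x t ** su (horizontal (\<eta> t))) ** ?A) ** ?B) (at t)"
      unfolding N_def
      by (rule mm.has_vector_derivative[OF mm.has_vector_derivative[OF x has_vector_derivative_su_exp] B])
    moreover have "(x t ** ?A) ** (- (su ?h ** ?B)) + (x t ** (?A ** su ?v) + (x t ** su (horizontal (\<eta> t))) ** ?A) ** ?B
        = x t ** (su (horizontal (\<eta> t)) ** ?A + su ?v ** ?A - ?A ** su ?h) ** ?B"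
      by (simp add: su_exp_comm matrix_mul_assoc mm.minus_right mm.diff_right mm.diff_left mm.add_left mm.add_right)
    moreover have "su (horizontal (\<eta> t)) ** ?A + su ?v ** ?A = su (\<eta> t) ** ?A"
      by (simp add: momentum_equation_solution(1)[OF \<eta>, of t] su_diff mm.diff_left)
    moreover have "su (\<eta> t) ** ?A = ?A ** su ?h"
    proof -
      have "su (\<eta> t) ** ?A = ?A ** (su_exp (- t) ?v ** su (\<eta> t)) ** ?A"
        by (simp add: matrix_mul_assoc su_exp_inverse)
      also have "\<dots> = ?A ** su ?h ** (su_exp (- t) ?v ** ?A)"
        unfolding momentum_equation_solution(2)[OF \<eta>, symmetric] by (simp add: matrix_mul_assoc)
      finally show ?thesis
        using su_exp_inverse[of "- t" ?v] by simp
    qed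
    ultimately show ?thesis by simp
  qed
  then obtain C where "N t = C" for t
    using has_vector_derivative_zero_constant[OF convex_UNIV, of N] by auto
  then have "N t = N 0" by simp
  then have "x 0 ** su_exp t ?h ** su_exp (- t) ?v = x t ** su_exp t ?v ** (su_exp (- t) ?h ** su_exp t ?h) ** su_exp (- t) ?v"
    by (simp add: N_def matrix_mul_assoc)
  also have "\<dots> = x t ** (su_exp t ?v ** su_exp (- t) ?v)"
    using su_exp_inverse[of "- t" ?h] by (simp add: matrix_mul_assoc)
  also have "\<dots> = x t"
    by (simp add: su_exp_inverse)
  finally show ?thesis by (simp add: geodesic_def)
qed

lemma hamiltonian_flow_SU2:
  assumes "q \<in> SU2"
  shows "fst (hamiltonian_flow SU2 SU2_hamiltonian t (q, covector q h)) = geodesic q h t"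
proof -
  obtain \<eta> where \<eta>: "\<And>t. (\<eta> has_vector_derivative cross3 (\<eta> t) (horizontal (\<eta> t))) (at t)" "\<eta> 0 = h"
    by (rule momentum_equation_exists[of h]) blast
  define \<gamma> where "\<gamma> = (\<lambda>t. (geodesic q h t, covector (geodesic q h t) (\<eta> t)))"
  have "hamiltonian_flow SU2 SU2_hamiltonian t (q, covector q h) = \<gamma> t"
    unfolding hamiltonian_flow_def
  proof (rule arg_cong[where f = "\<lambda>\<gamma>. \<gamma> t", OF the_equality])
    have "\<gamma> s \<in> cotangent_bundle SU2" for s
      using assms geodesic_in_SU2 by (auto simp: \<gamma>_def cotangent_bundle_SU2)
    moreover have "(\<gamma> has_vector_derivative hamiltonian_vector_field SU2 SU2_hamiltonian (\<gamma> s)) (at s)" for s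
    proof -
      have g: "(geodesic q h has_vector_derivative geodesic q h s ** su (horizontal (\<eta> s))) (at s)"
        using has_vector_derivative_geodesic[OF \<eta>(1)] \<eta>(2) by simp
      show ?thesis
        unfolding \<gamma>_def hamiltonian_vector_field_SU2[OF geodesic_in_SU2[OF assms]]
        using has_vector_derivative_Pair[OF g covector.has_vector_derivative[OF g \<eta>(1)]]
        by (simp add: add.commute)
    qed
    moreover have "\<gamma> 0 = (q, covector q h)"
      by (simp add: \<gamma>_def geodesic_def \<eta>(2))
    ultimately show "\<gamma> 0 = (q, covector q h) \<and> (\<forall>s. \<gamma> s \<in> cotangent_bundle SU2 \<and>
        (\<gamma> has_vector_derivative hamiltonian_vector_field SU2 SU2_hamiltonian (\<gamma> s)) (at s))"
      by blast
  next
    \<comment> \<open>An arbitrary integral curve is split into base point \<open>x\<close> and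
      momentum \<open>\<zeta>\<close>. The equation for \<open>\<zeta>\<close> is autonomous and the
      one for \<open>x\<close> is linear once \<open>\<zeta>\<close> is known.\<close>
    fix \<delta> assume \<delta>: "\<delta> 0 = (q, covector q h) \<and> (\<forall>s. \<delta> s \<in> cotangent_bundle SU2 \<and>
        (\<delta> has_vector_derivative hamiltonian_vector_field SU2 SU2_hamiltonian (\<delta> s)) (at s))"
    define x where "x s = fst (\<delta> s)" for s
    define \<zeta> where "\<zeta> s = momentum (fst (\<delta> s)) (snd (\<delta> s))" for s
    have eq: "x s \<in> SU2" "\<delta> s = (x s, covector (x s) (\<zeta> s))" for s
    proof -
      from \<delta> have "\<delta> s \<in> cotangent_bundle SU2" by blast
      then obtain y k where "y \<in> SU2" "\<delta> s = (y, covector y k)"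
        unfolding cotangent_bundle_SU2 by blast
      then show "x s \<in> SU2" "\<delta> s = (x s, covector (x s) (\<zeta> s))"
        by (auto simp: x_def \<zeta>_def momentum_covector)
    qed
    have *: "(x has_vector_derivative x s ** su (horizontal (\<zeta> s))) (at s)
      \<and> (\<zeta> has_vector_derivative cross3 (\<zeta> s) (horizontal (\<zeta> s))) (at s)" for s
    proof -
      define Z where "Z = (x s ** su (horizontal (\<zeta> s)), covector (x s ** su (horizontal (\<zeta> s))) (\<zeta> s)
        + covector (x s) (cross3 (\<zeta> s) (horizontal (\<zeta> s))))"
      have "(\<delta> has_vector_derivative hamiltonian_vector_field SU2 SU2_hamiltonian (\<delta> s)) (at s)"
        using \<delta> by blast
      then have Z: "(\<delta> has_vector_derivative Z) (at s)"
        unfolding eq(2)[of s] hamiltonian_vector_field_SU2[OF eq(1)] Z_def .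
      obtain a k where ak: "Z = (x s ** su a, covector (x s ** su a) (\<zeta> s) + covector (x s) k)"
        and k: "(\<zeta> has_vector_derivative k) (at s)"
        using velocity_cotangent_bundle[OF _ Z eq(2)] \<delta> unfolding \<zeta>_def[abs_def] by blast
      have "a = horizontal (\<zeta> s)"
        using ak eq(1)[of s] by (simp add: Z_def SU2_mult_left_cancel su_eq_iff)
      then have "covector (x s) k = covector (x s) (cross3 (\<zeta> s) (horizontal (\<zeta> s)))"
        using ak by (simp add: Z_def)
      then have "k = cross3 (\<zeta> s) (horizontal (\<zeta> s))"
        using momentum_covector[OF eq(1)[of s]] by metis
      moreover have "(x has_vector_derivative x s ** su (horizontal (\<zeta> s))) (at s)"
        using bounded_linear.has_vector_derivative[OF bounded_linear_fst Z]
        unfolding x_def[abs_def, symmetric] by (simp add: Z_def)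
      ultimately show ?thesis using k by simp
    qed
    have "x 0 = q" "\<zeta> 0 = h"
      using \<delta> assms by (simp_all add: x_def \<zeta>_def momentum_covector)
    then have "x s = geodesic q h s" "\<zeta> s = \<eta> s" for s
      using geodesic_unique[of \<zeta> x s] momentum_equation_unique[of \<zeta> \<eta> s] * \<eta> by auto
    then show "\<delta> = \<gamma>"
      unfolding \<gamma>_def by (metis eq(2))
  qed
  then show ?thesis
    by (simp add: \<gamma>_def)
qed

section \<open>The conjugate locus\<close>

lemma su_exp_scaleR: "su_exp t (c *\<^sub>R a) = su_exp (t * c) a"
  by (cases c "0::real" rule: linorder_cases) (simp_all add: su_exp_def su_scaleR su_zero mult.assoc)

lemma SU2_exp_covector: "q \<in> SU2 \<Longrightarrow> SU2_exp q (covector q h) = q ** (su_exp 1 h ** su_exp (- (h$1)) (axis 1 1))"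
  by (simp add: SU2_exp_def hamiltonian_flow_SU2 geodesic_def su_exp_scaleR matrix_mul_assoc)

text \<open>The chain rule for the two coefficients of \<open>su_exp 1\<close>, as functions of the
  norm, whose derivative is \<open>(h \<bullet> k) / norm h\<close>; hence meant for nonzero
  \<open>h\<close>.\<close>

definition su_exp_derivative :: "real^3 \<Rightarrow> real^3 \<Rightarrow> complex^2^2" where
  "su_exp_derivative h k =
     (- sin (norm h / 2) * (h \<bullet> k) / (2 * norm h)) *\<^sub>R mat 1
     + ((cos (norm h / 2) / (norm h)\<^sup>2 - 2 * sin (norm h / 2) / norm h ^ 3) * (h \<bullet> k)) *\<^sub>R su h
     + (2 * sin (norm h / 2) / norm h) *\<^sub>R su k"

lemma has_derivative_su_exp:
  assumes "h \<noteq> 0"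
  shows "(su_exp 1 has_derivative su_exp_derivative h) (at h)"
proof -
  let ?n = "\<lambda>k. (h \<bullet> k) / norm h"
  have n: "(norm has_derivative ?n) (at h)"
    using has_derivative_norm[OF assms] by (simp add: sgn_div_norm divide_inverse mult.commute inner_commute[of h])
  have c: "((\<lambda>h. cos (1 * norm h / 2)) has_derivative (\<lambda>k. - sin (norm h / 2) * (?n k / 2))) (at h)"
    by (auto intro!: derivative_eq_intros n simp: fun_eq_iff mult_ac)
  have s: "((\<lambda>h. 2 * sin (1 * norm h / 2) / norm h) has_derivative
      (\<lambda>k. (cos (norm h / 2) / norm h - 2 * sin (norm h / 2) / (norm h)\<^sup>2) * ?n k)) (at h)"
    by (rule derivative_eq_intros n refl | use assms in \<open>simp add: field_simps power2_eq_square fun_eq_iff\<close>)+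
  have "(su_exp 1 has_derivative (\<lambda>k. (- sin (norm h / 2) * (?n k / 2)) *\<^sub>R mat 1
      + ((2 * sin (1 * norm h / 2) / norm h) *\<^sub>R su k
      + ((cos (norm h / 2) / norm h - 2 * sin (norm h / 2) / (norm h)\<^sup>2) * ?n k) *\<^sub>R su h))) (at h)"
    unfolding su_exp_def[abs_def]
    by (intro has_derivative_add has_derivative_scaleR[OF s] has_derivative_scaleR_left c
        bounded_linear_imp_has_derivative bounded_linear_su)
  moreover have "(- sin (norm h / 2) * (?n k / 2)) *\<^sub>R mat 1
      + ((2 * sin (1 * norm h / 2) / norm h) *\<^sub>R su k
      + ((cos (norm h / 2) / norm h - 2 * sin (norm h / 2) / (norm h)\<^sup>2) * ?n k) *\<^sub>R su h)
      = su_exp_derivative h k" for k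
  proof -
    have "(cos (norm h / 2) / norm h - 2 * sin (norm h / 2) / (norm h)\<^sup>2) * ?n k
      = (cos (norm h / 2) / (norm h)\<^sup>2 - 2 * sin (norm h / 2) / norm h ^ 3) * (h \<bullet> k)"
      using assms by (simp add: field_simps power2_eq_square power3_eq_cube)
    then show ?thesis
      by (simp add: su_exp_derivative_def add.assoc add.commute[of "_ *\<^sub>R su k"])
  qed
  ultimately show ?thesis by simp
qed

text \<open>Left translation by \<open>q\<close> and right translation by the last exponential are
  injective, so both drop out of the kernel equation.\<close>

lemma conjugate_locus_iff_derivative:
  assumes "q \<in> SU2" "h \<noteq> 0"
  shows "covector q h \<in> conjugate_locus q \<longleftrightarrow>
    (\<exists>k. k \<noteq> 0 \<and> su_exp_derivative h k = k$1 *\<^sub>R (su_exp 1 h ** su (axis 1 1)))"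
proof -
  let ?V = "cotangent_space SU2 q" and ?e = "axis 1 1 :: real^3"
  let ?D = "frechet_derivative (SU2_exp q) (at (covector q h) within ?V)"
  let ?R = "\<lambda>h. su_exp (- (h$1)) ?e"
  define F where "F h = su_exp 1 h ** ?R h" for h
  define F' where "F' k = su_exp 1 h ** (- (k$1 *\<^sub>R (?R h ** su ?e))) + su_exp_derivative h k ** ?R h" for k
  have "(?R has_derivative (\<lambda>k. - (k$1 *\<^sub>R (?R h ** su ?e)))) (at h)"
  proof -
    have neg: "((\<lambda>h. - (h$1)) has_derivative (\<lambda>k. - (k$1))) (at h)"
      by (intro has_derivative_minus bounded_linear_imp_has_derivative bounded_linear_vec_nth)
    then show ?thesis
      using has_derivative_compose[OF neg has_vector_derivative_su_exp[of ?e "- (h$1)",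
            unfolded has_vector_derivative_def]] by simp
  qed
  then have F: "(F has_derivative F') (at h)"
    unfolding F_def[abs_def] F'_def[abs_def] by (rule mm.FDERIV[OF has_derivative_su_exp[OF assms(2)]])
  have momentum: "(momentum q has_derivative momentum q) (at (covector q h))"
    by (intro bounded_linear_imp_has_derivative momentum.bounded_linear_right)
  have "((\<lambda>p. F (momentum q p)) has_derivative (\<lambda>\<mu>. F' (momentum q \<mu>))) (at (covector q h))"
    using has_derivative_compose[OF momentum] F assms by (simp add: momentum_covector)
  then have G: "((\<lambda>p. q ** F (momentum q p)) has_derivative (\<lambda>\<mu>. q ** F' (momentum q \<mu>))) (at (covector q h) within ?V)"
    using bounded_linear.has_derivative[OF mm.bounded_linear_right] has_derivative_at_withinI by blast
  have eq: "SU2_exp q p = q ** F (momentum q p)" if "p \<in> ?V" for p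
    using that assms by (auto simp: cotangent_space_SU2 SU2_exp_covector momentum_covector F_def)
  have "covector q h \<in> ?V"
    using assms by (simp add: cotangent_space_SU2)
  then have exp: "(SU2_exp q has_derivative (\<lambda>\<mu>. q ** F' (momentum q \<mu>))) (at (covector q h) within ?V)"
    using eq G by (rule has_derivative_transform)
  \<comment> \<open>The chosen derivative within the cotangent space may differ from the computed
    one off that space; they are compared along lines inside it.\<close>
  have D: "?D (covector q k) = q ** F' k" for k
  proof -
    define c where "c t = covector q h + t *\<^sub>R covector q k" for t
    have "c t \<in> ?V" for t
      using assms by (simp add: c_def cotangent_space_SU2 flip: covector.scaleR_right covector.add_right)
    moreover have "(c has_vector_derivative covector q k) (at 0)"
      unfolding c_def by (auto intro!: derivative_eq_intros)
    moreover have "c 0 = covector q h" by (simp add: c_def)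
    ultimately have along: "((\<lambda>t. SU2_exp q (c t)) has_vector_derivative E (covector q k)) (at 0)"
      if "(SU2_exp q has_derivative E) (at (covector q h) within ?V)" for E
      using has_vector_derivative_along_curve[of "SU2_exp q" E c 0 ?V "covector q k"] that by simp
    have "(SU2_exp q has_derivative ?D) (at (covector q h) within ?V)"
      using frechet_derivative_works differentiableI[OF exp] by blast
    from vector_derivative_unique_at[OF along[OF this] along[OF exp]] show ?thesis
      using assms by (simp add: momentum_covector)
  qed
  have "F' k = (su_exp_derivative h k - k$1 *\<^sub>R (su_exp 1 h ** su ?e)) ** ?R h" for k
    by (simp add: F'_def su_exp_comm mm.diff_left mm.minus_right mm.scaleR_left mm.scaleR_right matrix_mul_assoc)
  moreover have "x ** ?R h = 0 \<longleftrightarrow> x = 0" for x :: "complex^2^2"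
    by (metis mm.zero_left matrix_mul_assoc matrix_mul_rid su_exp_inverse)
  moreover have "q ** x = 0 \<longleftrightarrow> x = 0" for x :: "complex^2^2"
    using SU2_mult_left_cancel[OF assms(1), of x 0] by (simp add: mm.zero_right)
  ultimately have kernel: "?D (covector q k) = 0 \<longleftrightarrow> su_exp_derivative h k = k$1 *\<^sub>R (su_exp 1 h ** su ?e)" for k
    by (simp add: D)
  have "su_exp_derivative h 0 = 0"
    by (simp add: su_exp_derivative_def su_zero)
  then have "?D 0 = 0"
    using kernel[of 0] by (simp add: covector.zero_right)
  moreover have "covector q k = 0 \<longleftrightarrow> k = 0" for k
    using momentum_covector[OF assms(1), of k] by (auto simp: covector.zero_right momentum.zero_right)
  moreover have "\<mu> \<in> ?V \<longleftrightarrow> (\<exists>k. \<mu> = covector q k)" for \<mu>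
    by (auto simp: cotangent_space_SU2[OF assms(1)])
  ultimately have "{\<mu> \<in> ?V. ?D \<mu> = 0} \<noteq> {0} \<longleftrightarrow> (\<exists>k. k \<noteq> 0 \<and> ?D (covector q k) = 0)"
    by (auto simp: set_eq_iff)
  then show ?thesis
    using \<open>covector q h \<in> ?V\<close> by (simp add: conjugate_locus_def kernel)
qed

text \<open>
  The kernel of the differential at \<open>h = (a, b, c)\<close>, with \<open>W = |h|\<^sup>2\<close>, \<open>s = sin \<tau> / |h|\<close> and
  \<open>d = 2 (\<tau> cos \<tau> - sin \<tau>) / |h|\<^sup>3\<close>.
\<close>

lemma kernel_system_solvable:
  fixes a b c d s W :: real
  assumes "b \<noteq> 0 \<or> c \<noteq> 0" "W > 0"
  shows "(\<exists>k::real^3. k \<noteq> 0 \<and> s * (b * k$2 + c * k$3) = 0 \<and>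
      d * (a * k$1 + b * k$2 + c * k$3) * a = W * d * k$1 \<and>
      d * (a * k$1 + b * k$2 + c * k$3) * b + 2 * s * k$2 = k$1 * s * c \<and>
      d * (a * k$1 + b * k$2 + c * k$3) * c + 2 * s * k$3 = - k$1 * s * b) \<longleftrightarrow> s = 0 \<or> d = 0"
    (is "(\<exists>k. ?P k) \<longleftrightarrow> _")
proof
  assume "\<exists>k. ?P k"
  then obtain k :: "real^3" where "k \<noteq> 0" and eq: "s * (b * k$2 + c * k$3) = 0"
    "d * (a * k$1 + b * k$2 + c * k$3) * a = W * d * k$1"
    "d * (a * k$1 + b * k$2 + c * k$3) * b + 2 * s * k$2 = k$1 * s * c"
    "d * (a * k$1 + b * k$2 + c * k$3) * c + 2 * s * k$3 = - k$1 * s * b" by blast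
  show "s = 0 \<or> d = 0"
  proof (rule ccontr)
    assume "\<not> (s = 0 \<or> d = 0)"
    then have "s \<noteq> 0" "d \<noteq> 0" by auto
    \<comment> \<open>The third equation times \<open>b\<close> plus the fourth times
      \<open>c\<close>: the right-hand sides cancel.\<close>
    have "d * (a * k$1 + b * k$2 + c * k$3) * (b\<^sup>2 + c\<^sup>2) + 2 * (s * (b * k$2 + c * k$3)) = 0"
      using eq(3,4) by algebra
    then have m: "a * k$1 + b * k$2 + c * k$3 = 0"
      using eq(1) \<open>d \<noteq> 0\<close> assms(1) by (auto simp: sum_power2_eq_zero_iff)
    have "k$1 = 0" using eq(2) \<open>d \<noteq> 0\<close> \<open>W > 0\<close> unfolding m by simp
    then show False
      using eq(3,4) \<open>k \<noteq> 0\<close> \<open>s \<noteq> 0\<close> unfolding m by (simp add: vec_eq_iff forall_3)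
  qed
next
  assume "s = 0 \<or> d = 0"
  then show "\<exists>k. ?P k"
  proof
    assume "s = 0"
    \<comment> \<open>A horizontal vector orthogonal to \<open>(b, c)\<close>, which annihilates
      both linear forms that remain.\<close>
    with assms(1) show ?thesis
      by (intro exI[of _ "vector [0, c, - b]"]) (auto simp: vec_eq_iff forall_3)
  next
    assume "d = 0"
    \<comment> \<open>With \<open>d = 0\<close> the last two equations follow from
      \<open>2 * k$2 = k$1 * c\<close> and \<open>2 * k$3 = - k$1 * b\<close>; taking
      \<open>k$1 = 2\<close> clears the factor.\<close>
    then show ?thesis
      by (intro exI[of _ "vector [2, c, - b]"]) (auto simp: vec_eq_iff forall_3)
  qed
qed

lemma conjugate_locus_iff:
  assumes "q \<in> SU2" "h$2 \<noteq> 0 \<or> h$3 \<noteq> 0"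
  defines "\<tau> \<equiv> norm h / 2"
  shows "covector q h \<in> conjugate_locus q \<longleftrightarrow> sin \<tau> * (sin \<tau> - \<tau> * cos \<tau>) = 0"
proof -
  have "h \<noteq> 0" using assms(2) by auto
  define w where "w = norm h"
  define s where "s = sin \<tau> / w"
  define d where "d = cos \<tau> / w\<^sup>2 - 2 * sin \<tau> / w ^ 3"
  have "w > 0" using \<open>h \<noteq> 0\<close> by (simp add: w_def)
  have \<tau>: "w / 2 = \<tau>" by (simp add: w_def \<tau>_def)
  have sd: "s * d = 0 \<longleftrightarrow> sin \<tau> * (sin \<tau> - \<tau> * cos \<tau>) = 0"
  proof -
    have "d = - 2 * (sin \<tau> - \<tau> * cos \<tau>) / w ^ 3"
      using \<open>w > 0\<close> by (simp add: d_def \<tau>_def field_simps power2_eq_square power3_eq_cube flip: w_def)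
    then show ?thesis using \<open>w > 0\<close> by (auto simp: s_def)
  qed
  \<comment> \<open>Eliminating the cosine makes the kernel equation linear in \<open>s\<close> and
    \<open>d\<close>; in the axis component the terms \<open>2 * s * k$1\<close> then
    cancel.\<close>
  have cos: "cos \<tau> = 2 * s + w\<^sup>2 * d"
    using \<open>w > 0\<close> by (simp add: s_def d_def field_simps power2_eq_square power3_eq_cube)
  have D: "su_exp_derivative h k - k$1 *\<^sub>R (su_exp 1 h ** su (axis 1 1))
      = (- s / 2 * (h \<bullet> k - k$1 * h$1)) *\<^sub>R mat 1
      + su ((d * (h \<bullet> k)) *\<^sub>R h + (2 * s) *\<^sub>R k
        - k$1 *\<^sub>R ((2 * s + w\<^sup>2 * d) *\<^sub>R axis 1 1 + s *\<^sub>R cross3 h (axis 1 1)))" for k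
    unfolding cos[symmetric]
    by (simp add: su_exp_derivative_def su_exp_def s_def d_def mm.add_left mm.scaleR_left su_mult_su
        su_add su_diff su_scaleR inner_axis \<tau> algebra_simps flip: w_def)
  have "su_exp_derivative h k = k$1 *\<^sub>R (su_exp 1 h ** su (axis 1 1)) \<longleftrightarrow>
      - s / 2 * (h \<bullet> k - k$1 * h$1) = 0 \<and> (d * (h \<bullet> k)) *\<^sub>R h + (2 * s) *\<^sub>R k
        - k$1 *\<^sub>R ((2 * s + w\<^sup>2 * d) *\<^sub>R axis 1 1 + s *\<^sub>R cross3 h (axis 1 1)) = 0" for k
    unfolding one_su_indep[symmetric] D[symmetric] by simp
  then have "su_exp_derivative h k = k$1 *\<^sub>R (su_exp 1 h ** su (axis 1 1)) \<longleftrightarrow>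
      s * (h$2 * k$2 + h$3 * k$3) = 0 \<and>
      d * (h$1 * k$1 + h$2 * k$2 + h$3 * k$3) * h$1 = w\<^sup>2 * d * k$1 \<and>
      d * (h$1 * k$1 + h$2 * k$2 + h$3 * k$3) * h$2 + 2 * s * k$2 = k$1 * s * h$3 \<and>
      d * (h$1 * k$1 + h$2 * k$2 + h$3 * k$3) * h$3 + 2 * s * k$3 = - k$1 * s * h$2" for k
    by (auto simp: vec_eq_iff forall_3 inner_vec_def sum_3 axis_def cross3_def algebra_simps)
  then show ?thesis
    unfolding conjugate_locus_iff_derivative[OF assms(1) \<open>h \<noteq> 0\<close>]
    using kernel_system_solvable[OF assms(2), of "w\<^sup>2" s d "h$1"] \<open>w > 0\<close> sd by simp
qed

text \<open>The zeros are simple: \<open>D\<close> is \<open>- t * (cos t)\<^sup>2\<close> where the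
  sine vanishes and \<open>t * (sin t)\<^sup>2\<close> where the second factor does. If either is
  zero, sine and cosine vanish together.\<close>

lemma conjugate_times_isolated:
  fixes t :: real
  assumes "sin t * (sin t - t * cos t) = 0" "t > 0"
  shows "\<forall>\<^sub>F x in at t. sin x * (sin x - x * cos x) \<noteq> 0"
proof -
  let ?g = "\<lambda>x::real. sin x * (sin x - x * cos x)"
  define D where "D = cos t * (sin t - t * cos t) + sin t * (t * sin t)"
  have "(?g has_real_derivative D) (at t)"
    unfolding D_def by (auto intro!: derivative_eq_intros simp: algebra_simps)
  then have "((\<lambda>x. ?g x / (x - t)) \<longlongrightarrow> D) (at t)"
    using assms(1) by (simp add: has_field_derivative_iff)
  moreover have "D \<noteq> 0"
  proof
    assume "D = 0"
    have "sin t = 0 \<or> sin t - t * cos t = 0" using assms(1) by simp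
    then have "sin t = 0 \<and> cos t = 0"
      using \<open>D = 0\<close> assms(2) by (auto simp: D_def)
    then show False using sin_cos_squared_add[of t] by simp
  qed
  ultimately have "\<forall>\<^sub>F x in at t. ?g x / (x - t) \<noteq> 0"
    by (rule tendsto_imp_eventually_ne)
  then show ?thesis by eventually_elim auto
qed

theorem proposition17:
  fixes q :: "complex^2^2"
  assumes "q \<in> SU2"
  shows "submanifold_of_codim 1 (cotangent_space SU2 q)
    (conjugate_locus q - {p. SU2_hamiltonian (q, p) = 0})"
proof (rule submanifold_of_codim_1_locally_sphere[where L = "momentum q"])
  let ?V = "cotangent_space SU2 q" and ?S = "conjugate_locus q - {p. SU2_hamiltonian (q, p) = 0}"
  let ?g = "\<lambda>x::real. sin x * (sin x - x * cos x)"
  show "bounded_linear (momentum q)" by (rule momentum.bounded_linear_right)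
  show "?S \<subseteq> ?V" by (auto simp: conjugate_locus_def)
  show "bij_betw (momentum q) ?V UNIV"
    by (rule bij_betwI[where g = "covector q"]) (auto simp: cotangent_space_SU2[OF assms] momentum_covector[OF assms])
  show "subspace ?V"
    unfolding cotangent_space_SU2[OF assms]
    using covector.bounded_linear_right bounded_linear.linear linear_subspace_image subspace_UNIV by blast
  have S_iff: "p \<in> ?S \<longleftrightarrow> (momentum q p $ 2 \<noteq> 0 \<or> momentum q p $ 3 \<noteq> 0) \<and> ?g (norm (momentum q p) / 2) = 0"
    if V: "p \<in> ?V" for p
  proof -
    obtain h where p: "p = covector q h" using V by (auto simp: cotangent_space_SU2[OF assms])
    have "SU2_hamiltonian (q, p) = 0 \<longleftrightarrow> h$2 = 0 \<and> h$3 = 0"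
      by (simp add: p SU2_hamiltonian_eq momentum_covector[OF assms] sum_power2_eq_zero_iff)
    then show ?thesis
      using conjugate_locus_iff[OF assms, of h] by (auto simp: p momentum_covector[OF assms])
  qed
  fix x assume "x \<in> ?S"
  then have x: "momentum q x $ 2 \<noteq> 0 \<or> momentum q x $ 3 \<noteq> 0" "?g (norm (momentum q x) / 2) = 0"
    using S_iff[of x] by (auto simp: conjugate_locus_def)
  then show "momentum q x \<noteq> 0 \<and> (\<exists>T. open T \<and> x \<in> T \<and>
    (\<forall>p\<in>T \<inter> ?V. p \<in> ?S \<longleftrightarrow> norm (momentum q p) = norm (momentum q x)))"
  proof (intro conjI)
    show "momentum q x \<noteq> 0" using x by auto
    then have "norm (momentum q x) / 2 > 0" by simp
    from conjugate_times_isolated[OF x(2) this] obtain I where I: "open I" "norm (momentum q x) / 2 \<in> I"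
      "\<And>t. t \<in> I \<Longrightarrow> t \<noteq> norm (momentum q x) / 2 \<Longrightarrow> ?g t \<noteq> 0"
      unfolding eventually_at_topological by blast
    \<comment> \<open>On \<open>T\<close> the momentum lies off the axis, and half its norm meets no
      zero of \<open>?g\<close> other than that of \<open>x\<close>, so the norm alone decides
      membership.\<close>
    define T where "T = (\<lambda>p. norm (momentum q p) / 2) -` I \<inter> ({p. momentum q p $ 2 \<noteq> 0} \<union> {p. momentum q p $ 3 \<noteq> 0})"
    have cont: "continuous_on UNIV (momentum q)"
      by (intro linear_continuous_on momentum.bounded_linear_right)
    have "open T"
      unfolding T_def using I(1)
      by (intro open_Int open_Un open_vimage open_Collect_neq continuous_intros cont) auto
    moreover have "x \<in> T" using x I(2) by (auto simp: T_def)
    moreover have "p \<in> ?S \<longleftrightarrow> norm (momentum q p) = norm (momentum q x)" if "p \<in> T \<inter> ?V" for p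
      using that S_iff[of p] I(3)[of "norm (momentum q p) / 2"] x(2) by (auto simp: T_def)
    ultimately show "\<exists>T. open T \<and> x \<in> T \<and>
      (\<forall>p\<in>T \<inter> ?V. p \<in> ?S \<longleftrightarrow> norm (momentum q p) = norm (momentum q x))" by blast
  qed
qed

end
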